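(* Let $\Gamma$ be a general chain of $g$ loops, let $d$ be an integer, $r\ge 0$ an integer, $k=r+1$, $\bar k=g-d+r$, and assume $\bar k\ge 0$. Put $\rho=g-k\bar k$. Then the Brill-Noether locus of degree $d$ and rank $r$ on $\Gamma$ is a union of $$\binom{g}{\rho}\,c(k,\bar k)$$ products of $\rho$ loops. These products correspond to the fillings of the $k\times\bar k$ rectangular Young diagram ($k$ columns, $\bar k$ rows) by $g-\rho=k\bar k$ distinct numbers from the set $\{1,2,\dots,g\}$, strictly increasing along rows and down columns ($c(k,\bar k)$ fillings for each choice of the $k\bar k$ numbers). The loops appearing in the product corresponding to a tableau are the loops $\Gamma_i$ whose indices $i$ do not appear in that tableau.
   Context: A tropical curve is a metric graph $\Gamma$. Divisors are elements of the free abelian group on the points of $\Gamma$. A function on $\Gamma$ is a continuous piecewise linear function with integral slopes; its divisor has at each point weight equal to the sum of the incoming slopes along the edges at that point. Two divisors are equivalent ($\equiv$) if they differ by the divisor of such a function; $\mathrm{Pic}^d(\Gamma)$ is the set of equivalence classes of divisors of degree $d$. A divisor $D$ has rank at least $r$ if for every effective divisor $D'$ of degree $r$, $D-D'$ is equivalent to an effective divisor. The Brill-Noether locus of degree $d$ and rank $r$ is the set of classes in $\mathrm{Pic}^d(\Gamma)$ of divisors of rank at least $r$. Chain of $g$ loops: for $i=1,\dots,g$ take segments $\mathscr L_i,\mathscr M_i$ of real lengths $l_i,m_i>0$ and identify the two ends of $\mathscr L_i$ with the two ends of $\mathscr M_i$; this gives a loop $\Gamma_i$ with two marked points $Q_{i-1},Q_i$.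 Glue consecutive loops $\Gamma_i,\Gamma_{i+1}$ at the point $Q_i$ ($i=1,\dots,g-1$); thus $Q_0\in\Gamma_1$ and $Q_g\in\Gamma_g$ are the remaining marked points. The chain is general if the lengths are generic, in the sense that no quotient $l_i/m_i$ equals the quotient of two positive integers less than $2g-2$. By a product of loops $\Gamma_i$, $i\in S$, in $\mathrm{Pic}^d(\Gamma)$ is meant a subset of the form $\{[\,E+\sum_{i\in S}x_i\,] : x_i\in\Gamma_i \text{ for } i\in S\}$ with $E$ a fixed divisor. $c(k,\bar k)$ denotes the number of standard Young tableaux of rectangular shape with $k$ columns and $\bar k$ rows (equal to $1$ if $\bar k=0$); $\binom{g}{\rho}=0$ if $\rho<0$ (the locus is then empty). *)

theory Defs
  imports "HOL-Analysis.Analysis" "HOL-Algebra.Free_Abelian_Groups"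
begin

section \<open>Metric graphs\<close>

text \<open>
  The fields \<open>source\<close> and \<open>target\<close> merely choose a parametrization of each edge
  \<open>e\<close> by the interval from \<open>0\<close> to \<open>len G e\<close>.
\<close>

record ('v, 'e) metric_graph =
  verts :: "'v set"
  edges :: "'e set"
  source :: "'e \<Rightarrow> 'v"
  target :: "'e \<Rightarrow> 'v"
  len :: "'e \<Rightarrow> real"

definition wf_metric_graph :: "('v, 'e) metric_graph \<Rightarrow> bool" where
  "wf_metric_graph G \<longleftrightarrow> finite (verts G) \<and> verts G \<noteq> {} \<and> finite (edges G) \<and>
     (\<forall>e\<in>edges G. source G e \<in> verts G \<and> target G e \<in> verts G \<and> 0 < len G e)"

text \<open>
  The quotient of the disjoint union of the segments by the identification of their ends is
  represented as the disjoint union of the vertices and of the open edges; \<open>edge_point G e\<close> is the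
  quotient map on the closed segment belonging to \<open>e\<close>.
\<close>

datatype ('v, 'e) gpoint = Vertex 'v | Inner 'e real

definition points :: "('v, 'e) metric_graph \<Rightarrow> ('v, 'e) gpoint set" where
  "points G = Vertex ` verts G \<union> {Inner e t | e t. e \<in> edges G \<and> 0 < t \<and> t < len G e}"

definition edge_point :: "('v, 'e) metric_graph \<Rightarrow> 'e \<Rightarrow> real \<Rightarrow> ('v, 'e) gpoint" where
  "edge_point G e t =
     (if t \<le> 0 then Vertex (source G e)
      else if len G e \<le> t then Vertex (target G e)
      else Inner e t)"


section \<open>Divisors and piecewise linear functions\<close>

type_synonym ('v, 'e) divisor = "('v, 'e) gpoint \<Rightarrow>\<^sub>0 int"

definition divisors :: "('v, 'e) metric_graph \<Rightarrow> ('v, 'e) divisor set" where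
  "divisors G = carrier (free_Abelian_group (points G))"

definition degree :: "('v, 'e) divisor \<Rightarrow> int" where
  "degree D = (\<Sum>p\<in>Poly_Mapping.keys D. Poly_Mapping.lookup D p)"

definition effective :: "('v, 'e) divisor \<Rightarrow> bool" where
  "effective D \<longleftrightarrow> (\<forall>p. 0 \<le> Poly_Mapping.lookup D p)"

definition integral_pl_on :: "real \<Rightarrow> (real \<Rightarrow> real) \<Rightarrow> bool" where
  "integral_pl_on a h \<longleftrightarrow> continuous_on {0..a} h \<and>
     (\<exists>B. finite B \<and>
        (\<forall>s t. 0 \<le> s \<and> s < t \<and> t \<le> a \<and> {s<..<t} \<inter> B = {} \<longrightarrow>
           (\<exists>(n::int) c. \<forall>x\<in>{s<..<t}. h x = c + of_int n * x)))"

definition graph_function :: "('v, 'e) metric_graph \<Rightarrow> (('v, 'e) gpoint \<Rightarrow> real) \<Rightarrow> bool" where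
  "graph_function G f \<longleftrightarrow> (\<forall>e\<in>edges G. integral_pl_on (len G e) (\<lambda>t. f (edge_point G e t)))"

definition right_slope :: "(real \<Rightarrow> real) \<Rightarrow> real \<Rightarrow> int" where
  "right_slope h t = (THE n. \<forall>\<^sub>F x in at_right t. h x = h t + of_int n * (x - t))"

definition left_slope :: "(real \<Rightarrow> real) \<Rightarrow> real \<Rightarrow> int" where
  "left_slope h t = (THE n. \<forall>\<^sub>F x in at_left t. h x = h t + of_int n * (x - t))"

text \<open>
  The sum of the incoming slopes at a point.  An edge running into the point contributes the left
  slope at its end, an edge running out of it contributes minus the right slope at its start; an
  edge with both ends at the same vertex contributes twice, once for each end.
\<close>

fun incoming_slopes ::
  "('v, 'e) metric_graph \<Rightarrow> (('v, 'e) gpoint \<Rightarrow> real) \<Rightarrow> ('v, 'e) gpoint \<Rightarrow> int" where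
  "incoming_slopes G f (Vertex v) =
     (\<Sum>e\<in>{e \<in> edges G. target G e = v}. left_slope (\<lambda>s. f (edge_point G e s)) (len G e)) +
     (\<Sum>e\<in>{e \<in> edges G. source G e = v}. - right_slope (\<lambda>s. f (edge_point G e s)) 0)"
| "incoming_slopes G f (Inner e t) =
     left_slope (\<lambda>s. f (edge_point G e s)) t - right_slope (\<lambda>s. f (edge_point G e s)) t"

definition is_divisor_of ::
  "('v, 'e) metric_graph \<Rightarrow> ('v, 'e) divisor \<Rightarrow> (('v, 'e) gpoint \<Rightarrow> real) \<Rightarrow> bool" where
  "is_divisor_of G D f \<longleftrightarrow> D \<in> divisors G \<and>
     (\<forall>p\<in>points G. Poly_Mapping.lookup D p = incoming_slopes G f p)"

definition div_equiv :: "('v, 'e) metric_graph \<Rightarrow> (('v, 'e) divisor \<times> ('v, 'e) divisor) set" where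
  "div_equiv G = {(D, D'). D \<in> divisors G \<and> D' \<in> divisors G \<and>
     (\<exists>f. graph_function G f \<and> is_divisor_of G (D - D') f)}"

definition div_class :: "('v, 'e) metric_graph \<Rightarrow> ('v, 'e) divisor \<Rightarrow> ('v, 'e) divisor set" where
  "div_class G D = div_equiv G `` {D}"

definition Pic :: "('v, 'e) metric_graph \<Rightarrow> int \<Rightarrow> ('v, 'e) divisor set set" where
  "Pic G d = {D \<in> divisors G. degree D = d} // div_equiv G"

definition rank_at_least :: "('v, 'e) metric_graph \<Rightarrow> ('v, 'e) divisor \<Rightarrow> nat \<Rightarrow> bool" where
  "rank_at_least G D r \<longleftrightarrow>
     (\<forall>D'\<in>divisors G. effective D' \<and> degree D' = int r \<longrightarrow>
        (\<exists>F\<in>divisors G. effective F \<and> (D - D', F) \<in> div_equiv G))"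

definition brill_noether_locus ::
  "('v, 'e) metric_graph \<Rightarrow> int \<Rightarrow> nat \<Rightarrow> ('v, 'e) divisor set set" where
  "brill_noether_locus G d r =
     {C \<in> Pic G d. \<exists>D\<in>divisors G. C = div_class G D \<and> rank_at_least G D r}"


section \<open>Chains of loops\<close>

text \<open>
  The vertex \<open>i\<close> is the marked point \<open>Q\<^sub>i\<close>; \<open>Seg_L i\<close> and \<open>Seg_M i\<close> are the two segments, of
  lengths \<open>l i\<close> and \<open>m i\<close>, forming the \<open>i\<close>-th loop.
\<close>

datatype chain_edge = Seg_L nat | Seg_M nat

fun edge_index :: "chain_edge \<Rightarrow> nat" where
  "edge_index (Seg_L i) = i"
| "edge_index (Seg_M i) = i"

definition loop_chain ::
  "nat \<Rightarrow> (nat \<Rightarrow> real) \<Rightarrow> (nat \<Rightarrow> real) \<Rightarrow> (nat, chain_edge) metric_graph" where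
  "loop_chain g l m =
     \<lparr>verts = {0..g},
      edges = Seg_L ` {1..g} \<union> Seg_M ` {1..g},
      source = (\<lambda>e. edge_index e - 1),
      target = edge_index,
      len = (\<lambda>e. case e of Seg_L i \<Rightarrow> l i | Seg_M i \<Rightarrow> m i)\<rparr>"

lemma wf_loop_chain:
  assumes "\<And>i. i \<in> {1..g} \<Longrightarrow> 0 < l i" and "\<And>i. i \<in> {1..g} \<Longrightarrow> 0 < m i"
  shows "wf_metric_graph (loop_chain g l m)"
  using assms by (auto simp: wf_metric_graph_def loop_chain_def)

definition chain_loop ::
  "nat \<Rightarrow> (nat \<Rightarrow> real) \<Rightarrow> (nat \<Rightarrow> real) \<Rightarrow> nat \<Rightarrow> (nat, chain_edge) gpoint set" where
  "chain_loop g l m i =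
     edge_point (loop_chain g l m) (Seg_L i) ` {0..l i} \<union>
     edge_point (loop_chain g l m) (Seg_M i) ` {0..m i}"

definition general_chain :: "nat \<Rightarrow> (nat \<Rightarrow> real) \<Rightarrow> (nat \<Rightarrow> real) \<Rightarrow> bool" where
  "general_chain g l m \<longleftrightarrow>
     (\<forall>i\<in>{1..g}. 0 < l i \<and> 0 < m i) \<and>
     (\<forall>i\<in>{1..g}. \<forall>p q :: int. 0 < p \<and> p < 2 * int g - 2 \<and> 0 < q \<and> q < 2 * int g - 2 \<longrightarrow>
        l i / m i \<noteq> of_int p / of_int q)"

definition is_loop_product ::
  "nat \<Rightarrow> (nat \<Rightarrow> real) \<Rightarrow> (nat \<Rightarrow> real) \<Rightarrow> int \<Rightarrow> nat set \<Rightarrow>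
     (nat, chain_edge) divisor set set \<Rightarrow> bool" where
  "is_loop_product g l m d S P \<longleftrightarrow>
     S \<subseteq> {1..g} \<and> P \<subseteq> Pic (loop_chain g l m) d \<and>
     (\<exists>E\<in>divisors (loop_chain g l m).
        P = {div_class (loop_chain g l m) (E + (\<Sum>i\<in>S. frag_of (x i))) | x.
               \<forall>i\<in>S. x i \<in> chain_loop g l m i})"


section \<open>Rectangular tableaux\<close>

text \<open>A cell is a pair (row, column); the rectangle has \<open>k\<close> columns and \<open>h\<close> rows.\<close>

definition cells :: "nat \<Rightarrow> nat \<Rightarrow> (nat \<times> nat) set" where
  "cells k h = {1..h} \<times> {1..k}"

definition fillings :: "nat \<Rightarrow> nat \<Rightarrow> nat set \<Rightarrow> (nat \<times> nat \<Rightarrow> nat) set" where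
  "fillings k h A =
     {T \<in> cells k h \<rightarrow>\<^sub>E A. inj_on T (cells k h) \<and>
        (\<forall>a b b'. (a, b) \<in> cells k h \<and> (a, b') \<in> cells k h \<and> b < b' \<longrightarrow> T (a, b) < T (a, b')) \<and>
        (\<forall>a a' b. (a, b) \<in> cells k h \<and> (a', b) \<in> cells k h \<and> a < a' \<longrightarrow> T (a, b) < T (a', b))}"

text \<open>
  Standard Young tableaux: there are as many cells as numbers, so an injective filling uses each
  number exactly once.  For \<open>h = 0\<close> there is exactly one (empty) filling.
\<close>

definition num_syt :: "nat \<Rightarrow> nat \<Rightarrow> nat" where
  "num_syt k h = card (fillings k h {1..k * h})"

definition int_binomial :: "nat \<Rightarrow> int \<Rightarrow> nat" where
  "int_binomial n j = (if j < 0 then 0 else n choose nat j)"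

end

theory Submission
  imports Defs "HOL-Library.Real_Mod"
begin

text \<open>
  Retracting the chain onto its \<open>i\<close>-th loop and summing positions along that loop gives a coordinate
  of a divisor modulo \<open>l i + m i\<close>; two divisors are equivalent iff they have the same degree and the
  same \<open>g\<close> coordinates.  Moving chips to the right as far as possible, one finds that a class of
  degree \<open>d\<close> is effective iff the following counter ends at most at \<open>d\<close>: it starts at \<open>0\<close>, and the
  \<open>i\<close>-th loop raises its value \<open>u\<close> by one unless the \<open>i\<close>-th coordinate is that of \<open>(d - u) Q\<^sub>i\<close>.
  Subtracting an effective divisor of degree \<open>r\<close> amounts to \<open>r\<close> additional unit jumps of the
  counter, and jumps made at the points \<open>Q\<^sub>i\<close> are the worst ones.  Let \<open>v\<^sub>i(j)\<close> be the largest
  value that \<open>j\<close> jumps can force by the end of loop \<open>i\<close>.  The numbers \<open>i + j - v\<^sub>i(j)\<close>,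
  \<open>0 \<le> j \<le> r\<close>, are the column heights of a Young diagram, which by genericity gains at most one
  box per loop, and the rank is at least \<open>r\<close> iff the final diagram contains the rectangle.
  Recording the loops at which the boxes of the rectangle are added gives the tableau; the box in
  row \<open>a\<close> and column \<open>b\<close> can be added at loop \<open>i\<close> only if the \<open>i\<close>-th coordinate is that of
  \<open>(d - (i - 1 + b - a)) Q\<^sub>i\<close>.
\<close>


section \<open>Weighted sums over finitely supported functions\<close>

definition frag_sum :: "('a \<Rightarrow> 'b::comm_ring_1) \<Rightarrow> ('a \<Rightarrow>\<^sub>0 int) \<Rightarrow> 'b" where
  "frag_sum \<phi> D = (\<Sum>p\<in>Poly_Mapping.keys D. of_int (Poly_Mapping.lookup D p) * \<phi> p)"

lemma frag_sum_superset:
  assumes "finite S" "Poly_Mapping.keys D \<subseteq> S"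
  shows "frag_sum \<phi> D = (\<Sum>p\<in>S. of_int (Poly_Mapping.lookup D p) * \<phi> p)"
  unfolding frag_sum_def using assms by (intro sum.mono_neutral_left) (auto simp: in_keys_iff)

lemma frag_sum_0 [simp]: "frag_sum \<phi> 0 = 0"
  by (simp add: frag_sum_def)

lemma frag_sum_of [simp]: "frag_sum \<phi> (frag_of p) = \<phi> p"
  by (simp add: frag_sum_def keys_frag_of)

lemma frag_sum_add: "frag_sum \<phi> (D + E) = frag_sum \<phi> D + frag_sum \<phi> E"
proof -
  let ?S = "Poly_Mapping.keys D \<union> Poly_Mapping.keys E"
  have "Poly_Mapping.keys (D + E) \<subseteq> ?S" by (rule Poly_Mapping.keys_add)
  then show ?thesis
    by (simp add: frag_sum_superset[of ?S] lookup_add sum.distrib[symmetric] distrib_right)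
qed

lemma frag_sum_diff: "frag_sum \<phi> (D - E) = frag_sum \<phi> D - frag_sum \<phi> E"
  using frag_sum_add[of \<phi> "D - E" E] by (simp add: algebra_simps)

lemma frag_sum_sum: "frag_sum \<phi> (\<Sum>i\<in>I. D i) = (\<Sum>i\<in>I. frag_sum \<phi> (D i))"
  by (induction I rule: infinite_finite_induct) (simp_all add: frag_sum_add)

lemma frag_sum_cmul: "frag_sum \<phi> (frag_cmul n D) = of_int n * frag_sum \<phi> D"
proof -
  have "frag_sum \<phi> (frag_cmul n D) =
      (\<Sum>p\<in>Poly_Mapping.keys D. of_int (Poly_Mapping.lookup (frag_cmul n D) p) * \<phi> p)"
    by (rule frag_sum_superset) (auto simp: keys_cmul)
  then show ?thesis by (simp add: frag_sum_def sum_distrib_left mult.assoc)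
qed

lemma frag_sum_cong:
  "(\<And>p. p \<in> Poly_Mapping.keys D \<Longrightarrow> \<phi> p = \<psi> p) \<Longrightarrow> frag_sum \<phi> D = frag_sum \<psi> D"
  by (simp add: frag_sum_def)

lemma frag_sum_eq_0: "(\<And>p. p \<in> Poly_Mapping.keys D \<Longrightarrow> \<phi> p = 0) \<Longrightarrow> frag_sum \<phi> D = 0"
  by (simp add: frag_sum_def)

lemma frag_sum_fun_add: "frag_sum (\<lambda>p. \<phi> p + \<psi> p) D = frag_sum \<phi> D + frag_sum \<psi> D"
  by (simp add: frag_sum_def distrib_left sum.distrib)

lemma frag_sum_fun_diff: "frag_sum (\<lambda>p. \<phi> p - \<psi> p) D = frag_sum \<phi> D - frag_sum \<psi> D"
  by (simp add: frag_sum_def right_diff_distrib sum_subtractf)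

lemma frag_sum_fun_cmul: "frag_sum (\<lambda>p. a * \<phi> p) D = a * frag_sum \<phi> D"
  by (simp add: frag_sum_def sum_distrib_left mult_ac)

lemma of_int_frag_sum: "of_int (frag_sum \<phi> D) = frag_sum (\<lambda>p. of_int (\<phi> p)) D"
  by (simp add: frag_sum_def)

lemma lookup_eq_frag_sum: "Poly_Mapping.lookup D p = frag_sum (\<lambda>q. of_bool (q = p)) D"
proof -
  have "frag_sum (\<lambda>q. of_bool (q = p) :: int) D =
      (\<Sum>q\<in>insert p (Poly_Mapping.keys D). of_int (Poly_Mapping.lookup D q) * of_bool (q = p))"
    by (rule frag_sum_superset) auto
  then show ?thesis by (simp add: sum.insert_remove sum.remove)
qed

lemma frag_sum_map_key:
  assumes f: "inj f" and "\<And>x. \<psi> (f x) = \<phi> x" "\<And>p. p \<notin> range f \<Longrightarrow> \<psi> p = 0"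
  shows "frag_sum \<phi> (Poly_Mapping.map_key f D) = frag_sum \<psi> D"
proof -
  have "frag_sum \<phi> (Poly_Mapping.map_key f D) =
      (\<Sum>p\<in>f ` (f -` Poly_Mapping.keys D). of_int (Poly_Mapping.lookup D p) * \<psi> p)"
    using assms(1,2)
    by (simp add: frag_sum_def keys_map_key map_key.rep_eq sum.reindex inj_on_subset
        del: image_vimage_eq)
  also have "\<dots> = frag_sum \<psi> D"
    unfolding frag_sum_def using assms(3) by (intro sum.mono_neutral_left) auto
  finally show ?thesis .
qed


section \<open>Piecewise linear functions on an interval\<close>

lemma right_slope_eqI:
  assumes "\<forall>\<^sub>F x in at_right t. h x = h t + of_int n * (x - t)"
  shows "right_slope h t = n"
  unfolding right_slope_def
proof (rule the_equality)
  fix n' assume "\<forall>\<^sub>F x in at_right t. h x = h t + of_int n' * (x - t)"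
  with assms have "\<forall>\<^sub>F x in at_right t. n' = n"
    using eventually_at_right_less[of t] by eventually_elim auto
  then show "n' = n" by simp
qed (fact assms)

lemma left_slope_eqI:
  assumes "\<forall>\<^sub>F x in at_left t. h x = h t + of_int n * (x - t)"
  shows "left_slope h t = n"
  unfolding left_slope_def
proof (rule the_equality)
  fix n' assume "\<forall>\<^sub>F x in at_left t. h x = h t + of_int n' * (x - t)"
  moreover have "\<forall>\<^sub>F x in at_left t. x < t"
    by (simp add: eventually_at_filter)
  ultimately have "\<forall>\<^sub>F x in at_left t. n' = n"
    using assms by eventually_elim auto
  then show "n' = n" by simp
qed (fact assms)

text \<open>The slope of \<open>pl_form A \<sigma> w\<close> is \<open>\<sigma>\<close> near \<open>-\<infinity>\<close> and drops by the weight of \<open>u\<close> at \<open>u\<close>.\<close>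

definition pl_form :: "real \<Rightarrow> int \<Rightarrow> (real \<Rightarrow>\<^sub>0 int) \<Rightarrow> real \<Rightarrow> real" where
  "pl_form A \<sigma> w t = A + of_int \<sigma> * t - frag_sum (\<lambda>u. max 0 (t - u)) w"

lemma pl_form_0: "Poly_Mapping.keys w \<subseteq> {0<..<a} \<Longrightarrow> pl_form A \<sigma> w 0 = A"
  by (auto simp: pl_form_def intro!: frag_sum_eq_0)

lemma pl_form_right_end:
  assumes "Poly_Mapping.keys w \<subseteq> {0<..<a}"
  shows "pl_form A \<sigma> w a = A + of_int \<sigma> * a - frag_sum (\<lambda>u. a - u) w"
proof -
  have "frag_sum (\<lambda>u. max 0 (a - u)) w = frag_sum (\<lambda>u. a - u) w"
    using assms by (intro frag_sum_cong) auto
  then show ?thesis by (simp add: pl_form_def)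
qed

lemma pl_form_affine:
  assumes "s \<le> t" "Poly_Mapping.keys w \<inter> {s<..<t} = {}"
  shows "pl_form A \<sigma> w t =
    pl_form A \<sigma> w s + of_int (\<sigma> - frag_sum (\<lambda>u. of_bool (u \<le> s)) w) * (t - s)"
proof -
  have "frag_sum (\<lambda>u. max 0 (t - u)) w - frag_sum (\<lambda>u. max 0 (s - u)) w =
      (t - s) * frag_sum (\<lambda>u. of_bool (u \<le> s)) w"
    unfolding frag_sum_fun_diff[symmetric] frag_sum_fun_cmul[symmetric]
  proof (rule frag_sum_cong)
    fix u assume "u \<in> Poly_Mapping.keys w"
    then have "u \<le> s \<or> t \<le> u" using assms(2) by force
    then show "max 0 (t - u) - max 0 (s - u) = (t - s) * of_bool (u \<le> s)"
      using assms(1) by auto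
  qed
  then show ?thesis by (simp add: pl_form_def of_int_frag_sum algebra_simps)
qed

lemma eventually_at_right_avoids_finite:
  fixes t :: real
  assumes "finite S"
  shows "\<forall>\<^sub>F x in at_right t. S \<inter> {t<..<x} = {}"
proof -
  have "\<forall>\<^sub>F x in at_right t. u \<notin> {t<..<x}" for u
    unfolding eventually_at_right_field
    by (cases "t < u") (auto intro: exI[of _ u] exI[of _ "t + 1"])
  then have "\<forall>\<^sub>F x in at_right t. \<forall>u\<in>S. u \<notin> {t<..<x}"
    using assms by (simp add: eventually_ball_finite)
  then show ?thesis by eventually_elim blast
qed

lemma eventually_at_left_avoids_finite:
  fixes t :: real
  assumes "finite S"
  shows "\<forall>\<^sub>F x in at_left t. S \<inter> {x..<t} = {}"
proof -
  have "\<forall>\<^sub>F x in at_left t. u \<notin> {x..<t}" for u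
    unfolding eventually_at_left_field
    by (cases "u < t") (auto intro: exI[of _ u] exI[of _ "t - 1"])
  then have "\<forall>\<^sub>F x in at_left t. \<forall>u\<in>S. u \<notin> {x..<t}"
    using assms by (simp add: eventually_ball_finite)
  then show ?thesis by eventually_elim blast
qed

lemma right_slope_pl_form:
  assumes "0 \<le> t" "t < a" and h: "\<And>x. x \<in> {0..a} \<Longrightarrow> h x = pl_form A \<sigma> w x"
  shows "right_slope h t = \<sigma> - frag_sum (\<lambda>u. of_bool (u \<le> t)) w"
proof (rule right_slope_eqI)
  have "\<forall>\<^sub>F x in at_right t. x \<in> {t<..<a}"
    using assms(2) by (rule eventually_at_right_real)
  moreover have "\<forall>\<^sub>F x in at_right t. Poly_Mapping.keys w \<inter> {t<..<x} = {}"
    by (rule eventually_at_right_avoids_finite) simp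
  ultimately show "\<forall>\<^sub>F x in at_right t.
      h x = h t + of_int (\<sigma> - frag_sum (\<lambda>u. of_bool (u \<le> t)) w) * (x - t)"
  proof eventually_elim
    case (elim x)
    then show ?case
      using pl_form_affine[of t x w A \<sigma>] assms by (simp add: h)
  qed
qed

lemma left_slope_pl_form:
  assumes "0 < t" "t \<le> a" and h: "\<And>x. x \<in> {0..a} \<Longrightarrow> h x = pl_form A \<sigma> w x"
  shows "left_slope h t = \<sigma> - frag_sum (\<lambda>u. of_bool (u < t)) w"
proof (rule left_slope_eqI)
  have "\<forall>\<^sub>F x in at_left t. x \<in> {0<..<t}"
    using assms(1) by (rule eventually_at_left_real)
  moreover have "\<forall>\<^sub>F x in at_left t. Poly_Mapping.keys w \<inter> {x..<t} = {}"
    by (rule eventually_at_left_avoids_finite) simp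
  ultimately show "\<forall>\<^sub>F x in at_left t.
      h x = h t + of_int (\<sigma> - frag_sum (\<lambda>u. of_bool (u < t)) w) * (x - t)"
  proof eventually_elim
    case (elim x)
    have "frag_sum (\<lambda>u. of_bool (u \<le> x) :: int) w = frag_sum (\<lambda>u. of_bool (u < t)) w"
    proof (rule frag_sum_cong)
      fix u assume "u \<in> Poly_Mapping.keys w"
      then have "u < x \<or> t \<le> u" using elim by force
      then show "of_bool (u \<le> x) = (of_bool (u < t) :: int)" using elim by auto
    qed
    moreover have "Poly_Mapping.keys w \<inter> {x<..<t} = {}" using elim by force
    ultimately show ?case
      using pl_form_affine[of x t w A \<sigma>] elim assms by (simp add: h algebra_simps)
  qed
qed

lemma slope_change_pl_form:
  assumes "0 < t" "t < a" and h: "\<And>x. x \<in> {0..a} \<Longrightarrow> h x = pl_form A \<sigma> w x"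
  shows "left_slope h t - right_slope h t = Poly_Mapping.lookup w t"
proof -
  have "left_slope h t - right_slope h t =
      frag_sum (\<lambda>u. of_bool (u \<le> t) - of_bool (u < t)) w"
    using assms(1,2) left_slope_pl_form[of t a h A \<sigma> w] right_slope_pl_form[of t a h A \<sigma> w]
    by (simp add: h frag_sum_fun_diff)
  also have "\<dots> = frag_sum (\<lambda>u. of_bool (u = t)) w"
    by (rule frag_sum_cong) auto
  finally show ?thesis by (simp add: lookup_eq_frag_sum)
qed

lemma integral_pl_on_pl_form:
  assumes h: "\<And>x. x \<in> {0..a} \<Longrightarrow> h x = pl_form A \<sigma> w x"
  shows "integral_pl_on a h"
  unfolding integral_pl_on_def
proof (intro conjI exI[of _ "Poly_Mapping.keys w"] allI impI)
  have "continuous_on {0..a} (pl_form A \<sigma> w)"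
    unfolding pl_form_def frag_sum_def by (intro continuous_intros)
  then show "continuous_on {0..a} h"
    by (rule continuous_on_eq) (simp add: h)
next
  fix s t assume st: "0 \<le> s \<and> s < t \<and> t \<le> a \<and> {s<..<t} \<inter> Poly_Mapping.keys w = {}"
  let ?n = "\<sigma> - frag_sum (\<lambda>u. of_bool (u \<le> s)) w"
  have "h x = (h s - of_int ?n * s) + of_int ?n * x" if "x \<in> {s<..<t}" for x
    using pl_form_affine[of s x w A \<sigma>] that st by (force simp: h algebra_simps)
  then show "\<exists>(n::int) c. \<forall>x\<in>{s<..<t}. h x = c + of_int n * x" by blast
qed simp

lemma affine_on_closed_interval:
  fixes h :: "real \<Rightarrow> real"
  assumes cont: "continuous_on {a..b} h" and "a < b"
    and h: "\<And>x. x \<in> {a<..<b} \<Longrightarrow> h x = c + n * x" and "x \<in> {a..b}"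
  shows "h x = c + n * x"
proof -
  have "h x - (c + n * x) = 0"
  proof (rule continuous_constant_on_closure[where S = "{a<..<b}" and f = "\<lambda>x. h x - (c + n * x)"])
    show "continuous_on (closure {a<..<b}) (\<lambda>x. h x - (c + n * x))"
      using cont \<open>a < b\<close> by (auto intro!: continuous_intros)
  qed (use assms in auto)
  then show ?thesis by simp
qed

lemma pl_form_append_affine:
  assumes b: "0 < b" "b < a" and w: "Poly_Mapping.keys w \<subseteq> {0<..<b}"
    and left: "\<forall>x\<in>{0..b}. h x = pl_form A \<sigma> w x"
    and right: "continuous_on {b..a} h" "\<forall>x\<in>{b<..<a}. h x = c + of_int n * x"
  shows "\<exists>w'. Poly_Mapping.keys w' \<subseteq> {0<..<a} \<and> (\<forall>x\<in>{0..a}. h x = pl_form A \<sigma> w' x)"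
proof (intro exI conjI ballI)
  define s where "s = \<sigma> - frag_sum (\<lambda>_. 1) w"
  let ?w' = "w + frag_cmul (s - n) (frag_of b)"
  show "Poly_Mapping.keys ?w' \<subseteq> {0<..<a}"
    using w b Poly_Mapping.keys_add[of w "frag_cmul (s - n) (frag_of b)"]
    by (force simp: keys_frag_of)
  fix x assume x: "x \<in> {0..a}"
  have split: "pl_form A \<sigma> ?w' x = pl_form A \<sigma> w x - of_int (s - n) * max 0 (x - b)"
    by (simp add: pl_form_def frag_sum_add frag_sum_cmul)
  show "h x = pl_form A \<sigma> ?w' x"
  proof (cases "x \<le> b")
    case True
    then show ?thesis using left x by (simp add: split)
  next
    case False
    have "frag_sum (\<lambda>u. of_bool (u \<le> b)) w = frag_sum (\<lambda>_. 1 :: int) w"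
      using w by (intro frag_sum_cong) auto
    moreover have "Poly_Mapping.keys w \<inter> {b<..<x} = {}" using w by force
    ultimately have "pl_form A \<sigma> w x = pl_form A \<sigma> w b + of_int s * (x - b)"
      using pl_form_affine[of b x w A \<sigma>] False by (simp add: s_def)
    moreover have "h y = c + of_int n * y" if "y \<in> {b, x}" for y
      using affine_on_closed_interval[OF right(1) b(2), of c n y] right(2) that b x False by auto
    moreover have "h b = pl_form A \<sigma> w b" using left b by simp
    ultimately show ?thesis using False by (simp add: split algebra_simps)
  qed
qed

lemma piecewise_affine_imp_pl_form:
  assumes "finite B" "continuous_on {0..a} h" "0 < a"
    and "\<And>s t. 0 \<le> s \<Longrightarrow> s < t \<Longrightarrow> t \<le> a \<Longrightarrow> {s<..<t} \<inter> B = {} \<Longrightarrow>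
      \<exists>(n::int) c. \<forall>x\<in>{s<..<t}. h x = c + of_int n * x"
  shows "\<exists>A \<sigma> w. Poly_Mapping.keys w \<subseteq> {0<..<a} \<and> (\<forall>x\<in>{0..a}. h x = pl_form A \<sigma> w x)"
  using assms
proof (induction B arbitrary: a rule: finite_linorder_max_induct)
  case empty
  obtain n :: int and c where "\<forall>x\<in>{0<..<a}. h x = c + of_int n * x"
    using empty.prems(3)[of 0 a] empty.prems(2) by auto
  then have "h x = pl_form c n 0 x" if "x \<in> {0..a}" for x
    using affine_on_closed_interval[OF empty.prems(1,2), of c n x] that by (simp add: pl_form_def)
  then show ?case by (intro exI[of _ c] exI[of _ n] exI[of _ 0]) simp
next
  case (insert b B)
  show ?case
  proof (cases "b \<in> {0<..<a}")
    case False
    then have "{s<..<t} \<inter> insert b B = {s<..<t} \<inter> B" if "0 \<le> s" "t \<le> a" for s t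
      using that by auto
    then show ?thesis using insert.IH[of a] insert.prems by simp
  next
    case True
    have cont: "continuous_on {0..b} h" "continuous_on {b..a} h"
      using insert.prems(1) True by (auto intro: continuous_on_subset)
    have "\<exists>(n::int) c. \<forall>x\<in>{s<..<t}. h x = c + of_int n * x"
      if "0 \<le> s" "s < t" "t \<le> b" "{s<..<t} \<inter> B = {}" for s t
      using insert.prems(3)[of s t] True that by auto
    then obtain A \<sigma> w where w: "Poly_Mapping.keys w \<subseteq> {0<..<b}" "\<forall>x\<in>{0..b}. h x = pl_form A \<sigma> w x"
      using insert.IH[of b, OF cont(1)] True by (simp, blast)
    have "{b<..<a} \<inter> insert b B = {}" using insert.hyps by force
    then obtain n :: int and c where right: "\<forall>x\<in>{b<..<a}. h x = c + of_int n * x"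
      using insert.prems(3)[of b a] True by auto
    have "0 < b" "b < a" using True by simp_all
    from pl_form_append_affine[OF this w cont(2) right] show ?thesis by blast
  qed
qed

lemma integral_pl_on_imp_pl_form:
  assumes "integral_pl_on a h" "0 < a"
  obtains A \<sigma> w where "Poly_Mapping.keys w \<subseteq> {0<..<a}"
    "\<And>x. x \<in> {0..a} \<Longrightarrow> h x = pl_form A \<sigma> w x"
proof -
  obtain B where B: "finite B" "continuous_on {0..a} h"
    and affine: "\<forall>s t. 0 \<le> s \<and> s < t \<and> t \<le> a \<and> {s<..<t} \<inter> B = {} \<longrightarrow>
      (\<exists>(n::int) c. \<forall>x\<in>{s<..<t}. h x = c + of_int n * x)"
    using assms(1) unfolding integral_pl_on_def by blast
  have "\<exists>A \<sigma> w. Poly_Mapping.keys w \<subseteq> {0<..<a} \<and> (\<forall>x\<in>{0..a}. h x = pl_form A \<sigma> w x)"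
    using B assms(2) by (rule piecewise_affine_imp_pl_form) (use affine in simp)
  then show thesis using that by blast
qed


section \<open>Divisors\<close>

lemma degree_eq_frag_sum: "degree D = frag_sum (\<lambda>_. 1) D"
  by (simp add: degree_def frag_sum_def)

lemma degree_diff: "degree (D - E) = degree D - degree E"
  by (simp add: degree_eq_frag_sum frag_sum_diff)

lemma effective_add: "effective D \<Longrightarrow> effective E \<Longrightarrow> effective (D + E)"
  by (simp add: effective_def lookup_add)

lemma effective_sum: "(\<And>i. i \<in> I \<Longrightarrow> effective (D i)) \<Longrightarrow> effective (\<Sum>i\<in>I. D i)"
  by (auto simp: effective_def lookup_sum intro: sum_nonneg)

lemma effective_frag_of: "effective (frag_of p)"
  by (simp add: effective_def)

lemma effective_frag_cmul: "0 \<le> n \<Longrightarrow> effective D \<Longrightarrow> effective (frag_cmul n D)"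
  by (simp add: effective_def)

lemma frag_sum_mono:
  fixes \<phi> \<psi> :: "('v, 'e) gpoint \<Rightarrow> int"
  assumes "effective D" "\<And>p. p \<in> Poly_Mapping.keys D \<Longrightarrow> \<phi> p \<le> \<psi> p"
  shows "frag_sum \<phi> D \<le> frag_sum \<psi> D"
  unfolding frag_sum_def using assms by (intro sum_mono mult_left_mono) (auto simp: effective_def)

lemma frag_sum_le_0_imp_eq_0:
  fixes \<phi> :: "('v, 'e) gpoint \<Rightarrow> int"
  assumes "effective D" "frag_sum \<phi> D \<le> 0" "\<And>p. 0 \<le> \<phi> p" "p \<in> Poly_Mapping.keys D"
  shows "\<phi> p = 0"
proof -
  have "0 \<le> frag_sum \<phi> D" using frag_sum_mono[of D "\<lambda>_. 0" \<phi>] assms by (simp add: frag_sum_eq_0)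
  then have "frag_sum \<phi> D = 0" using assms(2) by simp
  then have "of_int (Poly_Mapping.lookup D p) * \<phi> p = 0"
    unfolding frag_sum_def using assms
    by (subst (asm) sum_nonneg_eq_0_iff) (auto simp: effective_def)
  then show ?thesis using assms(4) by (simp add: in_keys_iff)
qed

lemma in_divisors_iff: "D \<in> divisors G \<longleftrightarrow> Poly_Mapping.keys D \<subseteq> points G"
  by (simp add: divisors_def)

lemma zero_in_divisors: "0 \<in> divisors G"
  by (simp add: in_divisors_iff)

lemma add_in_divisors: "D \<in> divisors G \<Longrightarrow> E \<in> divisors G \<Longrightarrow> D + E \<in> divisors G"
  unfolding in_divisors_iff using Poly_Mapping.keys_add[of D E] by blast

lemma diff_in_divisors: "D \<in> divisors G \<Longrightarrow> E \<in> divisors G \<Longrightarrow> D - E \<in> divisors G"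
  unfolding in_divisors_iff using keys_diff[of D E] by blast

lemma frag_of_in_divisors: "p \<in> points G \<Longrightarrow> frag_of p \<in> divisors G"
  by (simp add: in_divisors_iff keys_frag_of)

lemma frag_cmul_in_divisors: "D \<in> divisors G \<Longrightarrow> frag_cmul n D \<in> divisors G"
  unfolding in_divisors_iff using keys_cmul[of n D] by blast

lemma sum_in_divisors: "(\<And>i. i \<in> I \<Longrightarrow> D i \<in> divisors G) \<Longrightarrow> (\<Sum>i\<in>I. D i) \<in> divisors G"
  by (induction I rule: infinite_finite_induct) (auto intro: add_in_divisors zero_in_divisors)

definition edge_part :: "'e \<Rightarrow> ('v, 'e) divisor \<Rightarrow> (real \<Rightarrow>\<^sub>0 int)" where
  "edge_part e D = Poly_Mapping.map_key (Inner e) D"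

lemma inj_Inner: "inj (Inner e)"
  by (simp add: inj_def)

lemma lookup_edge_part: "Poly_Mapping.lookup (edge_part e D) t = Poly_Mapping.lookup D (Inner e t)"
  by (simp add: edge_part_def map_key.rep_eq inj_Inner)

lemma keys_edge_part: "D \<in> divisors G \<Longrightarrow> Poly_Mapping.keys (edge_part e D) \<subseteq> {0<..<len G e}"
  unfolding edge_part_def keys_map_key[OF inj_Inner] by (auto simp: in_divisors_iff points_def)

definition on_edge :: "'e \<Rightarrow> (real \<Rightarrow> 'b::zero) \<Rightarrow> ('v, 'e) gpoint \<Rightarrow> 'b" where
  "on_edge e \<phi> p = (case p of Vertex v \<Rightarrow> 0 | Inner e' t \<Rightarrow> if e' = e then \<phi> t else 0)"

lemma on_edge_simps [simp]:
  "on_edge e \<phi> (Vertex v) = 0"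
  "on_edge e \<phi> (Inner e' t) = (if e' = e then \<phi> t else 0)"
  by (simp_all add: on_edge_def)

lemma frag_sum_edge_part: "frag_sum \<phi> (edge_part e D) = frag_sum (on_edge e \<phi>) D"
  unfolding edge_part_def
proof (rule frag_sum_map_key[OF inj_Inner])
  show "on_edge e \<phi> p = 0" if "p \<notin> range (Inner e)" for p
    using that by (cases p) auto
qed simp


section \<open>Principal divisors on a metric graph\<close>

definition principal :: "('v, 'e) metric_graph \<Rightarrow> ('v, 'e) divisor \<Rightarrow> bool" where
  "principal G D \<longleftrightarrow> (\<exists>f. graph_function G f \<and> is_divisor_of G D f)"

lemma graph_function_on_edge:
  assumes e: "e \<in> edges G" "0 < len G e" and f: "graph_function G f" "is_divisor_of G D f"
  shows "\<exists>\<sigma>. \<forall>t\<in>{0..len G e}.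
    f (edge_point G e t) = pl_form (f (Vertex (source G e))) \<sigma> (edge_part e D) t"
proof -
  let ?h = "\<lambda>t. f (edge_point G e t)"
  have "integral_pl_on (len G e) ?h" using e f by (auto simp: graph_function_def)
  then obtain A \<sigma> w where w: "Poly_Mapping.keys w \<subseteq> {0<..<len G e}"
    and h: "\<And>t. t \<in> {0..len G e} \<Longrightarrow> ?h t = pl_form A \<sigma> w t"
    using integral_pl_on_imp_pl_form[OF _ e(2)] by metis
  have "w = edge_part e D"
  proof (rule poly_mapping_eqI)
    fix t show "Poly_Mapping.lookup w t = Poly_Mapping.lookup (edge_part e D) t"
    proof (cases "t \<in> {0<..<len G e}")
      case True
      then have "Inner e t \<in> points G" using e by (auto simp: points_def)
      then have "Poly_Mapping.lookup D (Inner e t) = left_slope ?h t - right_slope ?h t"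
        using f(2) unfolding is_divisor_of_def by (metis incoming_slopes.simps(2))
      also have "\<dots> = Poly_Mapping.lookup w t"
        using True by (intro slope_change_pl_form[OF _ _ h]) auto
      finally show ?thesis by (simp add: lookup_edge_part)
    next
      case False
      have "D \<in> divisors G" using f(2) by (simp add: is_divisor_of_def)
      then show ?thesis using False w keys_edge_part[of D G e] by (metis in_keys_iff subsetD)
    qed
  qed
  moreover have "f (Vertex (source G e)) = A"
    using h[of 0] e(2) pl_form_0[OF w] by (simp add: edge_point_def)
  ultimately show ?thesis using h by auto
qed

definition inflow :: "('v, 'e) metric_graph \<Rightarrow> ('v, 'e) divisor \<Rightarrow> ('e \<Rightarrow> int) \<Rightarrow> 'v \<Rightarrow> int" where
  "inflow G D \<sigma> v =
     (\<Sum>e\<in>{e \<in> edges G. target G e = v}. \<sigma> e - frag_sum (\<lambda>_. 1) (edge_part e D)) -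
     (\<Sum>e\<in>{e \<in> edges G. source G e = v}. \<sigma> e)"

lemma
  assumes wf: "wf_metric_graph G" and D: "D \<in> divisors G"
    and f: "\<And>e t. e \<in> edges G \<Longrightarrow> t \<in> {0..len G e} \<Longrightarrow>
      f (edge_point G e t) = pl_form (A e) (\<sigma> e) (edge_part e D) t"
  shows incoming_slopes_Vertex: "incoming_slopes G f (Vertex v) = inflow G D \<sigma> v"
    and incoming_slopes_Inner: "Inner e t \<in> points G \<Longrightarrow>
      incoming_slopes G f (Inner e t) = Poly_Mapping.lookup D (Inner e t)"
proof -
  have len: "0 < len G e" if "e \<in> edges G" for e
    using wf that by (simp add: wf_metric_graph_def)
  have "left_slope (\<lambda>t. f (edge_point G e t)) (len G e) = \<sigma> e - frag_sum (\<lambda>_. 1) (edge_part e D)"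
    if e: "e \<in> edges G" for e
  proof -
    have "frag_sum (\<lambda>t. of_bool (t < len G e)) (edge_part e D) =
        frag_sum (\<lambda>_. 1 :: int) (edge_part e D)"
      using keys_edge_part[OF D] by (intro frag_sum_cong) force
    then show ?thesis using left_slope_pl_form[OF len[OF e] order_refl f[OF e]] by simp
  qed
  moreover have "right_slope (\<lambda>t. f (edge_point G e t)) 0 = \<sigma> e" if e: "e \<in> edges G" for e
  proof -
    have "frag_sum (\<lambda>t. of_bool (t \<le> 0) :: int) (edge_part e D) = 0"
      using keys_edge_part[OF D] by (intro frag_sum_eq_0) force
    then show ?thesis using right_slope_pl_form[OF order_refl len[OF e] f[OF e]] by simp
  qed
  ultimately show "incoming_slopes G f (Vertex v) = inflow G D \<sigma> v"
    by (simp add: inflow_def sum_negf)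
  assume "Inner e t \<in> points G"
  then have e: "e \<in> edges G" and t: "0 < t" "t < len G e" by (auto simp: points_def)
  show "incoming_slopes G f (Inner e t) = Poly_Mapping.lookup D (Inner e t)"
    using slope_change_pl_form[OF t f[OF e]] by (simp add: lookup_edge_part)
qed

lemma principalI_inflow:
  assumes wf: "wf_metric_graph G" and D: "D \<in> divisors G"
    and heights: "\<And>e. e \<in> edges G \<Longrightarrow>
      A (target G e) = pl_form (A (source G e)) (\<sigma> e) (edge_part e D) (len G e)"
    and slopes: "\<And>v. v \<in> verts G \<Longrightarrow> Poly_Mapping.lookup D (Vertex v) = inflow G D \<sigma> v"
  shows "principal G D"
proof -
  define f where "f p = (case p of Vertex v \<Rightarrow> A v
    | Inner e t \<Rightarrow> pl_form (A (source G e)) (\<sigma> e) (edge_part e D) t)" for p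
  have f: "f (edge_point G e t) = pl_form (A (source G e)) (\<sigma> e) (edge_part e D) t"
    if "e \<in> edges G" "t \<in> {0..len G e}" for e t
    using that heights pl_form_0[OF keys_edge_part[OF D]] by (auto simp: edge_point_def f_def)
  have "graph_function G f"
    unfolding graph_function_def using integral_pl_on_pl_form[OF f] by blast
  moreover have "Poly_Mapping.lookup D p = incoming_slopes G f p" if "p \<in> points G" for p
  proof (cases p)
    case (Vertex v)
    then have "v \<in> verts G" using that by (auto simp: points_def)
    then show ?thesis using slopes incoming_slopes_Vertex[OF wf D f] by (simp add: Vertex)
  next
    case (Inner e t)
    then show ?thesis using that incoming_slopes_Inner[OF wf D f] by simp
  qed
  ultimately show ?thesis
    using D by (auto simp: principal_def is_divisor_of_def)
qed

lemma principal_iff_inflow: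
  assumes wf: "wf_metric_graph G" and D: "D \<in> divisors G"
  shows "principal G D \<longleftrightarrow> (\<exists>A (\<sigma> :: 'e \<Rightarrow> int).
    (\<forall>e\<in>edges G. A (target G e) = pl_form (A (source G e)) (\<sigma> e) (edge_part e D) (len G e)) \<and>
    (\<forall>v\<in>verts G. Poly_Mapping.lookup D (Vertex v) = inflow G D \<sigma> v))"
    (is "_ \<longleftrightarrow> (\<exists>A \<sigma>. ?heights A \<sigma> \<and> ?slopes \<sigma>)")
proof
  have len: "0 < len G e" if "e \<in> edges G" for e
    using wf that by (simp add: wf_metric_graph_def)
  assume "principal G D"
  then obtain f where f: "graph_function G f" "is_divisor_of G D f"
    by (auto simp: principal_def)
  have "\<forall>e\<in>edges G. \<exists>\<sigma>. \<forall>t\<in>{0..len G e}.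
      f (edge_point G e t) = pl_form (f (Vertex (source G e))) \<sigma> (edge_part e D) t"
    using graph_function_on_edge[OF _ len f] by blast
  then obtain \<sigma> :: "'e \<Rightarrow> int" where \<sigma>: "\<And>e t. e \<in> edges G \<Longrightarrow> t \<in> {0..len G e} \<Longrightarrow>
      f (edge_point G e t) = pl_form (f (Vertex (source G e))) (\<sigma> e) (edge_part e D) t"
    by metis
  have "?heights (\<lambda>v. f (Vertex v)) \<sigma>"
  proof
    fix e assume e: "e \<in> edges G"
    have "f (edge_point G e (len G e)) = f (Vertex (target G e))"
      using len[OF e] by (simp add: edge_point_def)
    then show "f (Vertex (target G e)) =
        pl_form (f (Vertex (source G e))) (\<sigma> e) (edge_part e D) (len G e)"
      using \<sigma>[OF e, of "len G e"] len[OF e] by simp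
  qed
  moreover have "?slopes \<sigma>"
    using f(2) incoming_slopes_Vertex[OF wf D \<sigma>] by (auto simp: is_divisor_of_def points_def)
  ultimately show "\<exists>A \<sigma>. ?heights A \<sigma> \<and> ?slopes \<sigma>"
    by (intro exI[of _ "\<lambda>v. f (Vertex v)"] exI[of _ \<sigma>] conjI)
qed (use principalI_inflow[OF wf D] in blast)


section \<open>The Jacobian of a chain of loops\<close>

fun position :: "(nat, chain_edge) gpoint \<Rightarrow> nat" where
  "position (Vertex v) = 2 * v"
| "position (Inner e t) = 2 * edge_index e - 1"

definition chips :: "nat \<Rightarrow> (nat, chain_edge) divisor \<Rightarrow> int" where
  "chips n D = frag_sum (\<lambda>p. of_bool (position p < n)) D"

lemma chips_0 [simp]: "chips 0 D = 0"
  by (simp add: chips_def frag_sum_eq_0)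

locale chain_of_loops =
  fixes g :: nat and l m :: "nat \<Rightarrow> real"
  assumes l_pos: "i \<in> {1..g} \<Longrightarrow> 0 < l i" and m_pos: "i \<in> {1..g} \<Longrightarrow> 0 < m i"
begin

abbreviation \<Gamma> :: "(nat, chain_edge) metric_graph" where
  "\<Gamma> \<equiv> loop_chain g l m"

abbreviation circumference :: "nat \<Rightarrow> real" where
  "circumference i \<equiv> l i + m i"

text \<open>
  The retraction of the chain onto its \<open>i\<close>-th loop, followed by the parametrization of that loop by
  the real line modulo its circumference in which \<open>Q\<^sub>i\<^sub>-\<^sub>1\<close> is \<open>0\<close> and \<open>Q\<^sub>i\<close> is \<open>l i\<close>, equivalently
  \<open>- m i\<close>.
\<close>

definition loop_coord :: "nat \<Rightarrow> (nat, chain_edge) gpoint \<Rightarrow> real" where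
  "loop_coord i p =
     (if position p + 1 < 2 * i then 0
      else if 2 * i \<le> position p then l i
      else case p of Vertex v \<Rightarrow> 0 | Inner e t \<Rightarrow> (case e of Seg_L j \<Rightarrow> t | Seg_M j \<Rightarrow> - t))"

abbreviation div_coord :: "nat \<Rightarrow> (nat, chain_edge) divisor \<Rightarrow> real" where
  "div_coord i \<equiv> frag_sum (loop_coord i)"

lemma wf_chain: "wf_metric_graph \<Gamma>"
  by (rule wf_loop_chain) (auto intro: l_pos m_pos)

lemma verts_chain: "verts \<Gamma> = {0..g}"
  by (simp add: loop_chain_def)

lemma Vertex_in_points: "v \<le> g \<Longrightarrow> Vertex v \<in> points \<Gamma>"
  by (simp add: points_def loop_chain_def)

lemma edge_index_of_point: "Inner e t \<in> points \<Gamma> \<Longrightarrow> edge_index e \<in> {1..g}"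
  by (auto simp: points_def loop_chain_def)

lemma position_le: "p \<in> points \<Gamma> \<Longrightarrow> position p \<le> 2 * g"
  by (auto simp: points_def loop_chain_def)

lemma chips_eq_degree:
  assumes "D \<in> divisors \<Gamma>"
  shows "chips (2 * g + 1) D = degree D"
  unfolding chips_def degree_eq_frag_sum
proof (rule frag_sum_cong)
  fix p assume "p \<in> Poly_Mapping.keys D"
  then have "position p \<le> 2 * g" using assms position_le by (auto simp: in_divisors_iff)
  then show "of_bool (position p < 2 * g + 1) = (1::int)" by simp
qed

lemma chips_vertex:
  assumes "D \<in> divisors \<Gamma>"
  shows "chips (2 * v + 1) D = chips (2 * v) D + Poly_Mapping.lookup D (Vertex v)"
  unfolding chips_def lookup_eq_frag_sum frag_sum_fun_add[symmetric]
proof (rule frag_sum_cong)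
  fix p assume "p \<in> Poly_Mapping.keys D"
  then have p: "p \<in> points \<Gamma>" using assms by (auto simp: in_divisors_iff)
  show "of_bool (position p < 2 * v + 1) =
      (of_bool (position p < 2 * v) + of_bool (p = Vertex v) :: int)"
  proof (cases p)
    case (Inner e t)
    then have "1 \<le> edge_index e" using edge_index_of_point[of e t] p by simp
    then have "2 * edge_index e - 1 < 2 * v + 1 \<longleftrightarrow> 2 * edge_index e - 1 < 2 * v" by presburger
    then show ?thesis by (simp add: Inner)
  qed auto
qed

lemma chips_loop_interior:
  assumes "D \<in> divisors \<Gamma>" "1 \<le> i"
  shows "chips (2 * i) D = chips (2 * i - 1) D +
    frag_sum (\<lambda>_. 1) (edge_part (Seg_L i) D) + frag_sum (\<lambda>_. 1) (edge_part (Seg_M i) D)"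
  unfolding chips_def frag_sum_edge_part frag_sum_fun_add[symmetric]
proof (rule frag_sum_cong)
  fix p assume "p \<in> Poly_Mapping.keys D"
  then have p: "p \<in> points \<Gamma>" using assms by (auto simp: in_divisors_iff)
  show "of_bool (position p < 2 * i) = (of_bool (position p < 2 * i - 1) +
      on_edge (Seg_L i) (\<lambda>_. 1) p + on_edge (Seg_M i) (\<lambda>_. 1) p :: int)"
  proof (cases p)
    case (Inner e t)
    then show ?thesis using edge_index_of_point[of e t] p assms(2) by (cases e) auto
  qed (use assms(2) in auto)
qed

lemma inflow_chain:
  fixes \<sigma> :: "chain_edge \<Rightarrow> int"
  defines "\<tau> \<equiv> \<lambda>i. if i \<in> {1..g} then \<sigma> (Seg_L i) + \<sigma> (Seg_M i) else 0"
  assumes D: "D \<in> divisors \<Gamma>" and "v \<le> g"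
  shows "inflow \<Gamma> D \<sigma> v = \<tau> v - (chips (2 * v) D - chips (2 * v - 1) D) - \<tau> (Suc v)"
proof -
  have into: "{e \<in> edges \<Gamma>. target \<Gamma> e = v} = (if v \<in> {1..g} then {Seg_L v, Seg_M v} else {})"
    by (auto simp: loop_chain_def)
  have out_of: "{e \<in> edges \<Gamma>. source \<Gamma> e = v} =
      (if v < g then {Seg_L (Suc v), Seg_M (Suc v)} else {})"
    by (force simp: loop_chain_def)
  show ?thesis
    using \<open>v \<le> g\<close> chips_loop_interior[OF D, of v]
    unfolding inflow_def into out_of by (cases v) (auto simp: \<tau>_def)
qed

lemma divisor_eq_inflow_iff:
  assumes D: "D \<in> divisors \<Gamma>"
  shows "(\<forall>v\<in>verts \<Gamma>. Poly_Mapping.lookup D (Vertex v) = inflow \<Gamma> D \<sigma> v) \<longleftrightarrow>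
    degree D = 0 \<and> (\<forall>i\<in>{1..g}. \<sigma> (Seg_L i) + \<sigma> (Seg_M i) = - chips (2 * i - 1) D)"
proof -
  define y where
    "y v = (if v \<in> {1..g} then \<sigma> (Seg_L v) + \<sigma> (Seg_M v) else 0) + chips (2 * v - 1) D" for v
  have y_0: "y 0 = 0" and y_Suc_g: "y (Suc g) = degree D"
    using chips_eq_degree[OF D] by (simp_all add: y_def)
  have "Poly_Mapping.lookup D (Vertex v) = inflow \<Gamma> D \<sigma> v \<longleftrightarrow> y (Suc v) = y v" if "v \<le> g" for v
    using inflow_chain[OF D that, of \<sigma>] chips_vertex[OF D, of v] by (auto simp: y_def)
  then have "(\<forall>v\<in>verts \<Gamma>. Poly_Mapping.lookup D (Vertex v) = inflow \<Gamma> D \<sigma> v) \<longleftrightarrow>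
      (\<forall>v\<le>g. y (Suc v) = y v)"
    by (auto simp: verts_chain)
  also have "\<dots> \<longleftrightarrow> (\<forall>v\<in>{..Suc g}. y v = 0)"
  proof (intro iffI ballI)
    fix v assume const: "\<forall>v\<le>g. y (Suc v) = y v" and "v \<in> {..Suc g}"
    then have "v \<le> Suc g" by simp
    then show "y v = 0" by (induction v) (use const y_0 in auto)
  qed auto
  also have "\<dots> \<longleftrightarrow> y (Suc g) = 0 \<and> (\<forall>i\<in>{1..g}. y i = 0)"
  proof -
    have "{..Suc g} = insert 0 (insert (Suc g) {1..g})" by auto
    then show ?thesis using y_0 by (simp only: ball_simps) simp
  qed
  also have "\<dots> \<longleftrightarrow> degree D = 0 \<and> (\<forall>i\<in>{1..g}. \<sigma> (Seg_L i) + \<sigma> (Seg_M i) = - chips (2 * i - 1) D)"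
    by (simp add: y_Suc_g) (auto simp: y_def eq_neg_iff_add_eq_0)
  finally show ?thesis .
qed

lemma ex_chain_heights_iff:
  fixes \<sigma> :: "chain_edge \<Rightarrow> int"
  assumes D: "D \<in> divisors \<Gamma>"
  shows "(\<exists>A. \<forall>e\<in>edges \<Gamma>.
      A (target \<Gamma> e) = pl_form (A (source \<Gamma> e)) (\<sigma> e) (edge_part e D) (len \<Gamma> e)) \<longleftrightarrow>
    (\<forall>i\<in>{1..g}.
      of_int (\<sigma> (Seg_L i)) * l i - frag_sum (\<lambda>u. l i - u) (edge_part (Seg_L i) D) =
      of_int (\<sigma> (Seg_M i)) * m i - frag_sum (\<lambda>u. m i - u) (edge_part (Seg_M i) D))"
    (is "?heights \<longleftrightarrow> (\<forall>i\<in>_. ?c i = ?c' i)")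
proof -
  have "?heights \<longleftrightarrow> (\<exists>A. \<forall>i\<in>{1..g}. A i = A (i - 1) + ?c i \<and> A i = A (i - 1) + ?c' i)"
    unfolding pl_form_right_end[OF keys_edge_part[OF D]]
    by (simp add: loop_chain_def ball_Un ball_conj_distrib add_diff_eq)
  also have "\<dots> \<longleftrightarrow> (\<forall>i\<in>{1..g}. ?c i = ?c' i)"
  proof
    assume eq: "\<forall>i\<in>{1..g}. ?c i = ?c' i"
    have "(\<Sum>j=1..i. ?c j) = (\<Sum>j=1..i - 1. ?c j) + ?c i" if "i \<in> {1..g}" for i
      using that by (cases i) auto
    then show "\<exists>A. \<forall>i\<in>{1..g}. A i = A (i - 1) + ?c i \<and> A i = A (i - 1) + ?c' i"
      using eq by (intro exI[of _ "\<lambda>i. \<Sum>j=1..i. ?c j"]) simp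
  qed fastforce
  finally show ?thesis .
qed

lemma div_coord_height_identity:
  assumes D: "D \<in> divisors \<Gamma>" and i: "i \<in> {1..g}"
  shows "frag_sum (\<lambda>u. l i - u) (edge_part (Seg_L i) D) -
      frag_sum (\<lambda>u. m i - u) (edge_part (Seg_M i) D) -
      m i * of_int (chips (2 * i - 1) D) + div_coord i D =
    l i * of_int (degree D) - circumference i *
      of_int (chips (2 * i - 1) D + frag_sum (\<lambda>_. 1) (edge_part (Seg_M i) D))"
  unfolding chips_def degree_eq_frag_sum of_int_add frag_sum_edge_part of_int_frag_sum
    frag_sum_fun_add[symmetric] frag_sum_fun_diff[symmetric] frag_sum_fun_cmul[symmetric]
proof (rule frag_sum_cong)
  fix p assume "p \<in> Poly_Mapping.keys D"
  then have p: "p \<in> points \<Gamma>" using D by (auto simp: in_divisors_iff)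
  show "on_edge (Seg_L i) (\<lambda>u. l i - u) p - on_edge (Seg_M i) (\<lambda>u. m i - u) p
      - m i * of_int (of_bool (position p < 2 * i - 1)) + loop_coord i p =
    l i * of_int 1 - circumference i *
      (of_int (of_bool (position p < 2 * i - 1)) + of_int (on_edge (Seg_M i) (\<lambda>_. 1) p))"
  proof (cases p)
    case (Vertex v)
    then show ?thesis using i by (auto simp: loop_coord_def)
  next
    case (Inner e t)
    then have "1 \<le> edge_index e" using edge_index_of_point[of e t] p by simp
    then show ?thesis using i Inner
      by (cases e; cases "edge_index e" i rule: linorder_cases) (auto simp: loop_coord_def)
  qed
qed

lemma ex_loop_slopes_iff:
  assumes D: "D \<in> divisors \<Gamma>" "degree D = 0" and i: "i \<in> {1..g}"
  shows "(\<exists>s t :: int.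
      of_int s * l i - frag_sum (\<lambda>u. l i - u) (edge_part (Seg_L i) D) =
        of_int t * m i - frag_sum (\<lambda>u. m i - u) (edge_part (Seg_M i) D) \<and>
      s + t = - chips (2 * i - 1) D) \<longleftrightarrow>
    [div_coord i D = 0] (rmod circumference i)"
    (is "(\<exists>s t. of_int s * _ - ?L = of_int t * _ - ?M \<and> s + t = - ?N) \<longleftrightarrow> _")
proof -
  define K where "K = ?N + frag_sum (\<lambda>_. 1) (edge_part (Seg_M i) D)"
  have "of_int s * l i - ?L = of_int (- ?N - s) * m i - ?M \<longleftrightarrow>
      0 = div_coord i D + of_int (s + K) * circumference i" for s
    using div_coord_height_identity[OF D(1) i] D(2) unfolding K_def[symmetric]
    by (simp add: algebra_simps) linarith
  moreover have "s + t = - ?N \<longleftrightarrow> t = - ?N - s" for s t :: int by linarith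
  ultimately have "(\<exists>s t. of_int s * l i - ?L = of_int t * m i - ?M \<and> s + t = - ?N) \<longleftrightarrow>
      (\<exists>s. 0 = div_coord i D + of_int (s + K) * circumference i)"
    by auto
  also have "\<dots> \<longleftrightarrow> (\<exists>n. 0 = div_coord i D + of_int n * circumference i)"
    by (metis diff_add_cancel)
  finally show ?thesis by (simp add: rcong_altdef)
qed

theorem principal_iff:
  assumes D: "D \<in> divisors \<Gamma>"
  shows "principal \<Gamma> D \<longleftrightarrow>
    degree D = 0 \<and> (\<forall>i\<in>{1..g}. [div_coord i D = 0] (rmod circumference i))"
proof -
  define R where "R i s t \<longleftrightarrow>
    of_int s * l i - frag_sum (\<lambda>u. l i - u) (edge_part (Seg_L i) D) =
      of_int t * m i - frag_sum (\<lambda>u. m i - u) (edge_part (Seg_M i) D) \<and>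
    s + t = - chips (2 * i - 1) D" for i and s t :: int
  have "principal \<Gamma> D \<longleftrightarrow>
      (\<exists>\<sigma>. degree D = 0 \<and> (\<forall>i\<in>{1..g}. R i (\<sigma> (Seg_L i)) (\<sigma> (Seg_M i))))"
    unfolding principal_iff_inflow[OF wf_chain D] divisor_eq_inflow_iff[OF D] R_def
      ball_conj_distrib ex_chain_heights_iff[OF D, symmetric]
    by blast
  also have "\<dots> \<longleftrightarrow> degree D = 0 \<and> (\<forall>i\<in>{1..g}. \<exists>s t. R i s t)"
  proof
    assume *: "degree D = 0 \<and> (\<forall>i\<in>{1..g}. \<exists>s t. R i s t)"
    then obtain s t where "\<forall>i\<in>{1..g}. R i (s i) (t i)" by metis
    then show "\<exists>\<sigma>. degree D = 0 \<and> (\<forall>i\<in>{1..g}. R i (\<sigma> (Seg_L i)) (\<sigma> (Seg_M i)))"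
      using * by (intro exI[of _ "case_chain_edge s t"]) simp
  qed blast
  also have "\<dots> \<longleftrightarrow> degree D = 0 \<and> (\<forall>i\<in>{1..g}. [div_coord i D = 0] (rmod circumference i))"
    unfolding R_def using ex_loop_slopes_iff[OF D] by (intro conj_cong ball_cong) auto
  finally show ?thesis .
qed

lemma div_equiv_iff:
  "(D, E) \<in> div_equiv \<Gamma> \<longleftrightarrow> D \<in> divisors \<Gamma> \<and> E \<in> divisors \<Gamma> \<and> degree D = degree E \<and>
     (\<forall>i\<in>{1..g}. [div_coord i D = div_coord i E] (rmod circumference i))"
proof (cases "D \<in> divisors \<Gamma> \<and> E \<in> divisors \<Gamma>")
  case True
  then have "(D, E) \<in> div_equiv \<Gamma> \<longleftrightarrow> principal \<Gamma> (D - E)"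
    by (simp add: div_equiv_def principal_def)
  also have "\<dots> \<longleftrightarrow> degree D = degree E \<and>
     (\<forall>i\<in>{1..g}. [div_coord i D = div_coord i E] (rmod circumference i))"
    using True by (simp add: principal_iff diff_in_divisors degree_diff frag_sum_diff
      rcong_conv_diff_rmod_eq_0)
  finally show ?thesis using True by blast
qed (auto simp: div_equiv_def)

lemma equiv_div_equiv: "equiv (divisors \<Gamma>) (div_equiv \<Gamma>)"
proof (rule equivI)
  show "div_equiv \<Gamma> \<subseteq> divisors \<Gamma> \<times> divisors \<Gamma>" by (auto simp: div_equiv_def)
  show "refl_on (divisors \<Gamma>) (div_equiv \<Gamma>)" by (auto simp: refl_on_def div_equiv_iff)
  show "sym (div_equiv \<Gamma>)" by (auto simp: sym_def div_equiv_iff intro: rcong_sym)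
  show "trans (div_equiv \<Gamma>)" by (auto simp: trans_def div_equiv_iff intro: rcong_trans)
qed

lemma div_class_eq_iff:
  "D \<in> divisors \<Gamma> \<Longrightarrow> E \<in> divisors \<Gamma> \<Longrightarrow>
    div_class \<Gamma> D = div_class \<Gamma> E \<longleftrightarrow> (D, E) \<in> div_equiv \<Gamma>"
  unfolding div_class_def using eq_equiv_class_iff[OF equiv_div_equiv] by blast

lemma in_Pic_iff: "C \<in> Pic \<Gamma> d \<longleftrightarrow> (\<exists>D\<in>divisors \<Gamma>. degree D = d \<and> C = div_class \<Gamma> D)"
  by (auto simp: Pic_def quotient_def div_class_def)

lemma chain_loop_subset_points: "i \<in> {1..g} \<Longrightarrow> chain_loop g l m i \<subseteq> points \<Gamma>"
  by (force simp: chain_loop_def edge_point_def points_def loop_chain_def)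

lemma loop_coord_other_loop:
  assumes "p \<in> chain_loop g l m j" "1 \<le> j" "j \<noteq> i"
  shows "loop_coord i p = (if j < i then 0 else l i)"
proof -
  have "p = Vertex (j - 1) \<or> p = Vertex j \<or> (\<exists>e t. edge_index e = j \<and> p = Inner e t)"
    using assms(1) by (force simp: chain_loop_def edge_point_def loop_chain_def)
  then show ?thesis using assms(2,3) by (auto simp: loop_coord_def)
qed

lemma ex_loop_point_with_coord:
  assumes i: "i \<in> {1..g}"
  shows "\<exists>p\<in>chain_loop g l m i. [loop_coord i p = c] (rmod circumference i)"
proof -
  define y where "y = c rmod circumference i"
  have "0 < circumference i" using l_pos[OF i] m_pos[OF i] by simp
  then have y: "0 \<le> y" "y < circumference i" by (simp_all add: y_def rmod_nonneg rmod_less)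
  have cong: "[y = c] (rmod circumference i)" by (simp add: y_def)
  show ?thesis
  proof (cases "y \<le> l i")
    case True
    let ?p = "edge_point \<Gamma> (Seg_L i) y"
    have "?p \<in> chain_loop g l m i" using True y by (auto simp: chain_loop_def)
    moreover have "loop_coord i ?p = y"
      using True y i l_pos[OF i] by (auto simp: edge_point_def loop_chain_def loop_coord_def)
    ultimately show ?thesis using cong by metis
  next
    case False
    let ?p = "edge_point \<Gamma> (Seg_M i) (circumference i - y)"
    have "?p \<in> chain_loop g l m i" using False y by (auto simp: chain_loop_def)
    moreover have "loop_coord i ?p = y - circumference i"
      using False y i l_pos[OF i] by (auto simp: edge_point_def loop_chain_def loop_coord_def)
    moreover have "[y - circumference i = y] (rmod circumference i)"
      unfolding rcong_altdef by (intro exI[of _ 1]) simp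
    ultimately show ?thesis using cong by (metis rcong_trans)
  qed
qed

lemma div_coord_add_loop_points:
  assumes "S \<subseteq> {1..g}" "i \<in> {1..g}" "\<And>j. j \<in> S \<Longrightarrow> x j \<in> chain_loop g l m j"
  shows "div_coord i (E + (\<Sum>j\<in>S. frag_of (x j))) =
    div_coord i E + l i * real (card (S \<inter> {i<..})) + (if i \<in> S then loop_coord i (x i) else 0)"
proof -
  have fin: "finite S" using assms(1) finite_subset by blast
  have "(\<Sum>j\<in>S. loop_coord i (x j)) =
      (\<Sum>j\<in>S. (if j = i then loop_coord i (x i) else 0) + (if j \<in> {i<..} then l i else 0))"
    using loop_coord_other_loop[OF assms(3)] assms(1) by (intro sum.cong) force+
  also have "\<dots> = (if i \<in> S then loop_coord i (x i) else 0) + (\<Sum>j\<in>S \<inter> {i<..}. l i)"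
    unfolding sum.distrib sum.inter_restrict[OF fin] using fin by simp
  finally show ?thesis by (simp add: frag_sum_add frag_sum_sum mult.commute)
qed

lemma add_loop_points_in_divisors:
  assumes "E \<in> divisors \<Gamma>" "S \<subseteq> {1..g}" "\<And>j. j \<in> S \<Longrightarrow> x j \<in> chain_loop g l m j"
  shows "E + (\<Sum>j\<in>S. frag_of (x j)) \<in> divisors \<Gamma>"
  using assms chain_loop_subset_points
  by (intro add_in_divisors sum_in_divisors frag_of_in_divisors) blast+

lemma degree_add_loop_points: "degree (E + (\<Sum>j\<in>S. frag_of (x j))) = degree E + int (card S)"
  by (simp add: degree_eq_frag_sum frag_sum_add frag_sum_sum)

lemma ex_loop_points_with_coords:
  assumes S: "S \<subseteq> {1..g}"
    and fixed: "\<And>i. i \<in> {1..g} - S \<Longrightarrow>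
      [div_coord i E + l i * real (card (S \<inter> {i<..})) = c i] (rmod circumference i)"
  shows "\<exists>x. (\<forall>j\<in>S. x j \<in> chain_loop g l m j) \<and>
    (\<forall>i\<in>{1..g}. [div_coord i (E + (\<Sum>j\<in>S. frag_of (x j))) = c i] (rmod circumference i))"
proof -
  let ?b = "\<lambda>i. div_coord i E + l i * real (card (S \<inter> {i<..}))"
  have "\<forall>i\<in>S. \<exists>p. p \<in> chain_loop g l m i \<and> [loop_coord i p = c i - ?b i] (rmod circumference i)"
    using ex_loop_point_with_coord S by blast
  then obtain x where x: "\<forall>i\<in>S. x i \<in> chain_loop g l m i"
    and coord: "\<forall>i\<in>S. [loop_coord i (x i) = c i - ?b i] (rmod circumference i)"
    by metis
  have "[div_coord i (E + (\<Sum>j\<in>S. frag_of (x j))) = c i] (rmod circumference i)"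
    if i: "i \<in> {1..g}" for i
  proof (cases "i \<in> S")
    case True
    then have "[?b i + loop_coord i (x i) = ?b i + (c i - ?b i)] (rmod circumference i)"
      using coord by (simp only: rcong_add_left_cancel)
    then show ?thesis using True div_coord_add_loop_points[OF S i, of x E] x by simp
  next
    case False
    then show ?thesis using fixed[of i] div_coord_add_loop_points[OF S i, of x E] x i by simp
  qed
  then show ?thesis using x by blast
qed

lemma ex_equiv_add_loop_points_iff:
  assumes E: "E \<in> divisors \<Gamma>" and D: "D \<in> divisors \<Gamma>" "degree D = degree E + int (card S)"
    and S: "S \<subseteq> {1..g}"
  shows "(\<exists>x. (\<forall>j\<in>S. x j \<in> chain_loop g l m j) \<and>
      (D, E + (\<Sum>j\<in>S. frag_of (x j))) \<in> div_equiv \<Gamma>) \<longleftrightarrow>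
    (\<forall>i\<in>{1..g} - S.
      [div_coord i E + l i * real (card (S \<inter> {i<..})) = div_coord i D] (rmod circumference i))"
    (is "?ex \<longleftrightarrow> ?fixed")
proof
  assume ?ex
  then obtain x where x: "\<forall>j\<in>S. x j \<in> chain_loop g l m j"
    and equiv: "(D, E + (\<Sum>j\<in>S. frag_of (x j))) \<in> div_equiv \<Gamma>" by blast
  show ?fixed
  proof
    fix i assume i: "i \<in> {1..g} - S"
    then have coord: "div_coord i (E + (\<Sum>j\<in>S. frag_of (x j))) =
        div_coord i E + l i * real (card (S \<inter> {i<..}))"
      using div_coord_add_loop_points[OF S, of i x E] x by simp
    show "[div_coord i E + l i * real (card (S \<inter> {i<..})) = div_coord i D] (rmod circumference i)"
      using equiv i unfolding coord[symmetric] div_equiv_iff by (blast intro: rcong_sym)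
  qed
next
  assume fixed: ?fixed
  obtain x where x: "\<forall>j\<in>S. x j \<in> chain_loop g l m j"
    and coords: "\<forall>i\<in>{1..g}.
      [div_coord i (E + (\<Sum>j\<in>S. frag_of (x j))) = div_coord i D] (rmod circumference i)"
    using ex_loop_points_with_coords[OF S bspec[OF fixed]] by blast
  have "(D, E + (\<Sum>j\<in>S. frag_of (x j))) \<in> div_equiv \<Gamma>"
    unfolding div_equiv_iff using D coords rcong_sym add_loop_points_in_divisors[OF E S] x
    by (auto simp only: degree_add_loop_points)
  then show ?ex using x by blast
qed

lemma ex_divisor_with_coords:
  "\<exists>D\<in>divisors \<Gamma>. degree D = d \<and> (\<forall>i\<in>{1..g}. [div_coord i D = c i] (rmod circumference i))"
proof -
  define E :: "(nat, chain_edge) divisor" where "E = frag_cmul (d - int g) (frag_of (Vertex 0))"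
  have "E \<in> divisors \<Gamma>"
    unfolding E_def by (intro frag_cmul_in_divisors frag_of_in_divisors Vertex_in_points) simp
  moreover have "degree E = d - int g" by (simp add: E_def degree_eq_frag_sum frag_sum_cmul)
  moreover obtain x where "\<forall>j\<in>{1..g}. x j \<in> chain_loop g l m j"
    and "\<forall>i\<in>{1..g}. [div_coord i (E + (\<Sum>j\<in>{1..g}. frag_of (x j))) = c i] (rmod circumference i)"
    using ex_loop_points_with_coords[of "{1..g}" E c] by auto
  ultimately show ?thesis
    by (intro bexI[of _ "E + (\<Sum>j\<in>{1..g}. frag_of (x j))"] conjI add_loop_points_in_divisors)
      (auto simp: degree_add_loop_points)
qed

end


section \<open>Rectangular tableaux\<close>

lemma finite_cells [simp]: "finite (cells k h)" and card_cells: "card (cells k h) = k * h"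
  by (simp_all add: cells_def)

lemma finite_fillings: "finite A \<Longrightarrow> finite (fillings k h A)"
  by (rule finite_subset[of _ "cells k h \<rightarrow>\<^sub>E A"]) (auto simp: fillings_def intro: finite_PiE)

lemma
  assumes "T \<in> fillings k h A"
  shows filling_in: "c \<in> cells k h \<Longrightarrow> T c \<in> A"
    and inj_on_filling: "inj_on T (cells k h)"
    and filling_extensional: "T \<in> extensional (cells k h)"
  using assms by (auto simp: fillings_def PiE_iff)

lemma filling_less:
  assumes T: "T \<in> fillings k h A" and c: "(a, b) \<in> cells k h" "(a', b') \<in> cells k h"
    and "a \<le> a'" "b \<le> b'" "(a, b) \<noteq> (a', b')"
  shows "T (a, b) < T (a', b')"
proof -
  have corner: "(a, b') \<in> cells k h" using c by (auto simp: cells_def)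
  have row: "b < b' \<Longrightarrow> T (a, b) < T (a, b')" and column: "a < a' \<Longrightarrow> T (a, b') < T (a', b')"
    using T c corner by (auto simp: fillings_def)
  consider "a = a'" "b < b'" | "a < a'" "b = b'" | "a < a'" "b < b'"
    using assms(4-6) by fastforce
  then show ?thesis
  proof cases
    case 3
    then show ?thesis using row column less_trans by blast
  qed (use row column in auto)
qed

lemma card_filling_image: "T \<in> fillings k h A \<Longrightarrow> card (T ` cells k h) = k * h"
  by (simp add: card_image inj_on_filling card_cells)

lemma size_le_if_filling: "T \<in> fillings k h {1..g} \<Longrightarrow> k * h \<le> g"
  using card_mono[of "{1..g}" "T ` cells k h"] card_filling_image filling_in by fastforce

lemma card_diff_filling_image:
  assumes T: "T \<in> fillings k h {1..g}"
  shows "int (card ({1..g} - T ` cells k h)) = int g - int (k * h)"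
proof -
  have "T ` cells k h \<subseteq> {1..g}" using filling_in[OF T] by blast
  then have "card ({1..g} - T ` cells k h) = g - k * h"
    using card_filling_image[OF T] by (simp add: card_Diff_subset)
  then show ?thesis using size_le_if_filling[OF T] by (simp only: of_nat_diff)
qed

lemma ex_strict_mono_on_into:
  fixes A :: "'a::linorder set" and B :: "'b::wellorder set"
  assumes "finite A" "finite B" "card A \<le> card B"
  shows "\<exists>f. strict_mono_on A f \<and> f ` A \<subseteq> B"
proof -
  define rank where "rank x = card {y \<in> A. y < x}" for x
  obtain \<beta> where \<beta>: "bij_betw \<beta> {..<card B} B" "strict_mono_on {..<card B} \<beta>"
    using ex_bij_betw_strict_mono_card[OF \<open>finite B\<close>] .
  have rank_less: "rank x < card B" if "x \<in> A" for x
  proof -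
    have "{y \<in> A. y < x} \<subset> A" using that by auto
    then have "rank x < card A" unfolding rank_def by (rule psubset_card_mono[OF \<open>finite A\<close>])
    then show ?thesis using assms(3) by simp
  qed
  have rank_mono: "rank x < rank y" if "x \<in> A" "y \<in> A" "x < y" for x y
    unfolding rank_def using that \<open>finite A\<close> by (intro psubset_card_mono) auto
  have "strict_mono_on A (\<beta> \<circ> rank)"
    using rank_mono rank_less strict_mono_onD[OF \<beta>(2)] by (auto intro!: strict_mono_onI)
  moreover have "(\<beta> \<circ> rank) ` A \<subseteq> B"
    using rank_less bij_betwE[OF \<beta>(1)] by auto
  ultimately show ?thesis by blast
qed

lemma card_fillings_mono:
  assumes "finite A" "finite B" "card A \<le> card B"
  shows "card (fillings k h A) \<le> card (fillings k h B)"
proof -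
  obtain f where f: "strict_mono_on A f" "f ` A \<subseteq> B"
    using ex_strict_mono_on_into[OF assms] by blast
  have inj: "inj_on f A" using f(1) by (rule strict_mono_on_imp_inj_on)
  let ?relabel = "\<lambda>T. restrict (f \<circ> T) (cells k h)"
  have "inj_on ?relabel (fillings k h A)"
  proof (rule inj_onI)
    fix T T' assume T: "T \<in> fillings k h A" "T' \<in> fillings k h A" and eq: "?relabel T = ?relabel T'"
    show "T = T'"
    proof (rule extensionalityI[OF filling_extensional[OF T(1)] filling_extensional[OF T(2)]])
      fix c assume c: "c \<in> cells k h"
      then have "f (T c) = f (T' c)" using fun_cong[OF eq, of c] by simp
      then show "T c = T' c"
        using inj_onD[OF inj] filling_in[OF T(1) c] filling_in[OF T(2) c] by blast
    qed
  qed
  moreover have "?relabel ` fillings k h A \<subseteq> fillings k h B"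
  proof (rule image_subsetI)
    fix T assume T: "T \<in> fillings k h A"
    have "inj_on (f \<circ> T) (cells k h)"
      using inj_on_filling[OF T] inj filling_in[OF T]
      by (intro comp_inj_on) (auto intro: inj_on_subset)
    then have "inj_on (?relabel T) (cells k h)"
      by (simp cong: inj_on_cong)
    moreover have "f (T c) < f (T c')" if "c \<in> cells k h" "c' \<in> cells k h" "T c < T c'" for c c'
      using strict_mono_onD[OF f(1)] filling_in[OF T] that by blast
    ultimately show "?relabel T \<in> fillings k h B"
      using f(2) filling_in[OF T] filling_less[OF T] unfolding fillings_def by (auto simp: PiE_iff)
  qed
  ultimately show ?thesis
    using finite_fillings[OF assms(2)] by (rule card_inj_on_le)
qed

lemma card_fillings_eq_num_syt:
  assumes "finite A" "card A = k * h"
  shows "card (fillings k h A) = num_syt k h"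
  unfolding num_syt_def using assms by (intro antisym card_fillings_mono) auto

lemma card_fillings:
  assumes A: "finite A"
  shows "card (fillings k h A) = (card A choose (k * h)) * num_syt k h"
proof -
  let ?I = "{B. B \<subseteq> A \<and> card B = k * h}"
  have fin: "finite B" if "B \<in> ?I" for B using that A finite_subset by blast
  have image: "T ` cells k h = B" if "T \<in> fillings k h B" "B \<in> ?I" for T B
    using that by (intro card_subset_eq fin) (auto simp: card_filling_image filling_in)
  have "fillings k h A = (\<Union>B\<in>?I. fillings k h B)"
  proof (intro equalityI subsetI)
    fix T assume T: "T \<in> fillings k h A"
    then have "T \<in> fillings k h (T ` cells k h)" by (auto simp: fillings_def PiE_iff)
    moreover have "T ` cells k h \<in> ?I" using T filling_in card_filling_image by blast
    ultimately show "T \<in> (\<Union>B\<in>?I. fillings k h B)" by blast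
  next
    fix T assume "T \<in> (\<Union>B\<in>?I. fillings k h B)"
    then show "T \<in> fillings k h A" by (force simp: fillings_def PiE_iff)
  qed
  also have "card \<dots> = (\<Sum>B\<in>?I. card (fillings k h B))"
  proof (rule card_UN_disjoint)
    show "finite ?I" using A by simp
    show "\<forall>B\<in>?I. finite (fillings k h B)" using fin finite_fillings by blast
    show "\<forall>B\<in>?I. \<forall>C\<in>?I. B \<noteq> C \<longrightarrow> fillings k h B \<inter> fillings k h C = {}"
      using image by blast
  qed
  also have "\<dots> = (\<Sum>B\<in>?I. num_syt k h)"
    using fin by (intro sum.cong[OF refl] card_fillings_eq_num_syt) simp_all
  also have "\<dots> = (card A choose (k * h)) * num_syt k h"
    using n_subsets[OF A, of "k * h"] by simp
  finally show ?thesis .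
qed

text \<open>Meaningful only if \<open>i\<close> is an entry of \<open>T\<close>.\<close>

definition entry_content :: "nat \<Rightarrow> nat \<Rightarrow> (nat \<times> nat \<Rightarrow> nat) \<Rightarrow> nat \<Rightarrow> int" where
  "entry_content k h T i = (case inv_into (cells k h) T i of (a, b) \<Rightarrow> int b - int a)"

lemma entry_content:
  "T \<in> fillings k h A \<Longrightarrow> (a, b) \<in> cells k h \<Longrightarrow> entry_content k h T (T (a, b)) = int b - int a"
  using inv_into_f_f[OF inj_on_filling, of T k h A "(a, b)"] by (simp add: entry_content_def)

lemma entry_content_diff_le:
  assumes T: "T \<in> fillings k h {1..g}" and T': "T' \<in> fillings k h {1..g}"
    and i: "i \<in> T ` cells k h" "i \<in> T' ` cells k h"
  shows "\<bar>entry_content k h T i - entry_content k h T' i\<bar> \<le> int g"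
proof -
  obtain a b a' b' where c: "(a, b) \<in> cells k h" "(a', b') \<in> cells k h"
    and i_eq: "i = T (a, b)" "i = T' (a', b')" using i by auto
  have bounds: "1 \<le> a" "a \<le> h" "1 \<le> b" "b \<le> k" "1 \<le> a'" "a' \<le> h" "1 \<le> b'" "b' \<le> k"
    using c by (auto simp: cells_def)
  then have "0 \<le> (int k - 1) * (int h - 1)" by simp
  then have "int k + int h - 1 \<le> int (k * h)" by (simp add: algebra_simps)
  also have "\<dots> \<le> int g" using size_le_if_filling[OF T] by (simp only: of_nat_le_iff)
  finally have "\<bar>(int b - int a) - (int b' - int a')\<bar> \<le> int g" using bounds by linarith
  then show ?thesis using entry_content[OF T c(1)] entry_content[OF T' c(2)] by (simp flip: i_eq)
qed

lemma strict_mono_on_eqI_image: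
  fixes f f' :: "'a::wellorder \<Rightarrow> 'b::linorder"
  assumes "strict_mono_on A f" "strict_mono_on A f'" "f ` A = f' ` A" "x \<in> A"
  shows "f x = f' x"
  using \<open>x \<in> A\<close>
proof (induction x rule: less_induct)
  case (less x)
  have "f' x \<le> f x"
    if mono: "strict_mono_on A f" "strict_mono_on A f'" and image: "f ` A = f' ` A"
      and IH: "\<And>y. y < x \<Longrightarrow> y \<in> A \<Longrightarrow> f y = f' y" for f f' :: "'a \<Rightarrow> 'b"
  proof -
    obtain y where y: "y \<in> A" "f x = f' y" using image less.prems by blast
    have "\<not> y < x" using IH[of y] y strict_mono_onD[OF mono(1) y(1) less.prems] by auto
    then show ?thesis
      using y less.prems strict_mono_on_leD[OF mono(2), of x y] by simp
  qed
  from this[of f f'] this[of f' f] show ?case using assms(1-3) less.IH by fastforce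
qed

definition diagonal :: "nat \<Rightarrow> nat \<Rightarrow> int \<Rightarrow> (nat \<times> nat) set" where
  "diagonal k h \<delta> = {(a, b). (a, b) \<in> cells k h \<and> int b - int a = \<delta>}"

lemma filling_image_diagonal:
  "T \<in> fillings k h A \<Longrightarrow> T ` diagonal k h \<delta> = {i \<in> T ` cells k h. entry_content k h T i = \<delta>}"
  by (auto simp: diagonal_def entry_content)

lemma filling_eqI_diagonals:
  assumes T: "T \<in> fillings k h A" and T': "T' \<in> fillings k h A'"
    and image: "\<And>\<delta>. T ` diagonal k h \<delta> = T' ` diagonal k h \<delta>"
  shows "T = T'"
proof (rule extensionalityI[OF filling_extensional[OF T] filling_extensional[OF T']])
  fix c assume "c \<in> cells k h"
  define \<delta> where "\<delta> = int (snd c) - int (fst c)"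
  define cell where "cell a = (a, nat (int a + \<delta>))" for a
  let ?rows = "fst ` diagonal k h \<delta>"
  have cell_fst: "cell (fst c) = c" if "c \<in> diagonal k h \<delta>" for c
    using that by (auto simp: cell_def diagonal_def)
  have cell_rows: "cell ` ?rows = diagonal k h \<delta>"
    by (simp add: image_image cell_fst)
  have mono: "strict_mono_on ?rows (U \<circ> cell)" if U: "U \<in> fillings k h B" for U B
  proof (rule strict_mono_onI)
    fix a a' assume a: "a \<in> ?rows" "a' \<in> ?rows" "a < a'"
    then have "cell a \<in> cells k h" "cell a' \<in> cells k h"
      using cell_fst by (auto simp: diagonal_def)
    then show "(U \<circ> cell) a < (U \<circ> cell) a'"
      using filling_less[OF U] a(3) by (simp add: cell_def)
  qed
  have c: "c \<in> diagonal k h \<delta>"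
    using \<open>c \<in> cells k h\<close> by (auto simp: diagonal_def \<delta>_def)
  have "(T \<circ> cell) (fst c) = (T' \<circ> cell) (fst c)"
  proof (rule strict_mono_on_eqI_image[OF mono[OF T] mono[OF T']])
    show "(T \<circ> cell) ` ?rows = (T' \<circ> cell) ` ?rows"
      using image[of \<delta>] by (simp only: image_comp[symmetric] cell_rows)
  qed (use c in simp)
  then show "T c = T' c" by (simp add: cell_fst[OF c])
qed


section \<open>A chip game\<close>

definition advance :: "(int \<Rightarrow> bool) \<Rightarrow> int \<Rightarrow> int" where
  "advance B u = (if B u then u else u + 1)"

text \<open>
  A counter starts at \<open>0\<close>.  The \<open>i\<close>-th round raises it by one, unless its value is blocked by
  \<open>W i\<close>.  An adversary may moreover raise it by \<open>j\<close> in total, before, between and after the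
  rounds; \<open>reach W i j\<close> is the largest value that can be forced by the end of round \<open>i\<close>.
\<close>

fun reach :: "(nat \<Rightarrow> int \<Rightarrow> bool) \<Rightarrow> nat \<Rightarrow> nat \<Rightarrow> int" where
  "reach W 0 j = int j"
| "reach W (Suc i) 0 = advance (W (Suc i)) (reach W i 0)"
| "reach W (Suc i) (Suc j) = max (advance (W (Suc i)) (reach W i (Suc j))) (reach W (Suc i) j + 1)"

lemma advance_mono: "u \<le> v \<Longrightarrow> advance B u \<le> advance B v"
  by (cases "u = v") (auto simp: advance_def)

lemma advance_le: "advance B u \<le> u + 1" and advance_ge: "u \<le> advance B u"
  by (auto simp: advance_def)

lemma reach_cong:
  "(\<And>i' u. i' \<in> {1..i} \<Longrightarrow> W i' u \<longleftrightarrow> W' i' u) \<Longrightarrow> reach W i j = reach W' i j"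
  by (induction W i j rule: reach.induct) (auto simp: advance_def)

lemma reach_cases [case_names start advance jump]:
  obtains "i = 0" "j = 0"
  | i' where "i = Suc i'" "reach W (Suc i') j = advance (W (Suc i')) (reach W i' j)"
  | j' where "j = Suc j'" "reach W i (Suc j') = reach W i j' + 1"
  by (cases i; cases j) (fastforce simp: max_def split: if_splits)+

lemma blocked_after_blocked_round:
  "i \<noteq> 0 \<Longrightarrow> W i (reach W (i - 1) 0) \<Longrightarrow> W i (reach W i 0)"
  by (cases i) (auto simp: advance_def)

lemma reach_no_jumps_diff:
  assumes "i \<le> n"
  shows "reach W n 0 - reach W i 0 = int (card {j \<in> {i<..n}. \<not> W j (reach W (j - 1) 0)})"
    (is "_ = int (card (?J n))")
  using assms
proof (induction n rule: dec_induct)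
  case (step n)
  have split: "{i<..Suc n} = insert (Suc n) {i<..n}" using step.hyps by auto
  show ?case
  proof (cases "W (Suc n) (reach W n 0)")
    case True
    then have "?J (Suc n) = ?J n" unfolding split by auto
    then show ?thesis using step.IH True by (simp add: advance_def)
  next
    case False
    then have "?J (Suc n) = insert (Suc n) (?J n)" unfolding split by auto
    then show ?thesis using step.IH False by (simp add: advance_def)
  qed
qed simp

lemma reach_add_1_le: "reach W i j + 1 \<le> reach W i (Suc j)"
  by (cases i) auto

lemma reach_add_le: "reach W i j + int q \<le> reach W i (j + q)"
proof (induction q)
  case (Suc q)
  then show ?case using reach_add_1_le[of W i "j + q"] by simp
qed simp

lemma advance_reach_le: "advance (W (Suc i)) (reach W i j) \<le> reach W (Suc i) j"
  by (cases j) auto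

lemma reach_le_reach_Suc: "reach W i j \<le> reach W (Suc i) j"
  using advance_reach_le advance_ge order_trans by blast

lemma reach_Suc_le: "reach W (Suc i) j \<le> reach W i j + 1"
proof (induction j)
  case 0
  then show ?case using advance_le by simp
next
  case (Suc j)
  then show ?case using advance_le reach_add_1_le[of W i j] by auto
qed

lemma reach_le: "reach W i j \<le> int i + int j"
proof (induction i)
  case (Suc i)
  then show ?case using reach_Suc_le[of W i j] by simp
qed simp

lemma blocked_if_reach_Suc_eq:
  assumes "reach W (Suc i) j = reach W i j"
  shows "W (Suc i) (reach W i j)"
  using advance_reach_le[of W i j] assms by (auto simp: advance_def split: if_splits)

lemma reach_Suc_add_ge:
  assumes "\<And>u. \<not> (W (Suc i) u \<and> W (Suc i) (u + 1))" "1 \<le> q"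
  shows "reach W i j + int q + 1 \<le> reach W (Suc i) (j + q)"
proof (cases "W (Suc i) (reach W i j)")
  case False
  then have "reach W i j + 1 \<le> reach W (Suc i) j"
    using advance_reach_le[of W i j] by (simp add: advance_def)
  then show ?thesis using reach_add_le[of W "Suc i" j q] by simp
next
  case True
  then have "\<not> W (Suc i) (reach W i j + 1)" using assms(1) by blast
  then have "reach W i j + 2 \<le> advance (W (Suc i)) (reach W i (Suc j))"
    using advance_mono[OF reach_add_1_le[of W i j], of "W (Suc i)"] by (simp add: advance_def)
  then have "reach W i j + 2 \<le> reach W (Suc i) (Suc j)" by simp
  then show ?thesis using reach_add_le[of W "Suc i" "Suc j" "q - 1"] assms(2) by simp
qed

text \<open>
  The numbers \<open>height W i j\<close>, \<open>j = 0, 1, \<dots>\<close>, are the column heights of a Young diagram, which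
  gains a box in column \<open>j\<close> in each round that leaves \<open>reach W _ j\<close> unchanged.
\<close>

definition height :: "(nat \<Rightarrow> int \<Rightarrow> bool) \<Rightarrow> nat \<Rightarrow> nat \<Rightarrow> int" where
  "height W i j = int i + int j - reach W i j"

lemma height_0 [simp]: "height W 0 j = 0"
  by (simp add: height_def)

lemma height_nonneg: "0 \<le> height W i j"
  using reach_le[of W i j] by (simp add: height_def)

lemma height_antimono:
  assumes "j \<le> j'"
  shows "height W i j' \<le> height W i j"
proof (rule lift_Suc_antimono_le[OF _ assms])
  show "height W i (Suc n) \<le> height W i n" for n
    using reach_add_1_le[of W i n] by (simp add: height_def)
qed

lemma height_Suc: "height W (Suc i) j = height W i j + of_bool (reach W (Suc i) j = reach W i j)"
  using reach_Suc_le[of W i j] reach_le_reach_Suc[of W i j] by (auto simp: height_def)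

lemma height_Suc_geI:
  assumes "int a \<le> height W i j + 1" "j \<noteq> 0 \<Longrightarrow> int a \<le> height W i (j - 1)"
    and "W (Suc i) (int i + int j + 1 - int a)"
  shows "int a \<le> height W (Suc i) j"
proof (cases "int a \<le> height W i j")
  case True
  then show ?thesis by (simp add: height_Suc)
next
  case False
  then have reach: "reach W i j = int i + int j + 1 - int a"
    using assms(1) by (simp add: height_def)
  then have adv: "advance (W (Suc i)) (reach W i j) = reach W i j"
    using assms(3) by (simp add: advance_def)
  have "reach W (Suc i) j = reach W i j"
  proof (cases j)
    case (Suc j')
    then have "reach W (Suc i) j' + 1 \<le> reach W i j"
      using assms(2) reach reach_Suc_le[of W i j'] by (simp add: height_def)
    then show ?thesis using adv Suc by simp
  qed (use adv in simp)
  then show ?thesis using reach by (simp add: height_def)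
qed

lemma height_ge_if_filling:
  assumes T: "T \<in> fillings k h A" "0 \<notin> A"
    and blocked: "\<And>a b. (a, b) \<in> cells k h \<Longrightarrow> W (T (a, b)) (int (T (a, b)) - 1 + (int b - int a))"
  shows "(a, b) \<in> cells k h \<Longrightarrow> T (a, b) \<le> i \<Longrightarrow> int a \<le> height W i (b - 1)"
proof (induction i arbitrary: a b)
  case 0
  then show ?case using filling_in[OF T(1) 0(1)] T(2) by simp
next
  case (Suc i)
  have cell: "1 \<le> a" "1 \<le> b" using Suc.prems by (auto simp: cells_def)
  show ?case
  proof (cases "T (a, b) \<le> i")
    case True
    then have "int a \<le> height W i (b - 1)" using Suc by blast
    then show ?thesis by (simp add: height_Suc)
  next
    case False
    then have entry: "T (a, b) = Suc i" using Suc.prems by simp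
    have earlier: "int a' \<le> height W i (b' - 1)"
      if "(a', b') \<in> cells k h" "a' \<le> a" "b' \<le> b" "a' + b' < a + b" for a' b'
      using Suc.IH[OF that(1)] filling_less[OF T(1) that(1) Suc.prems(1) that(2,3)] that(4) entry
      by auto
    show ?thesis
    proof (rule height_Suc_geI)
      show "int a \<le> height W i (b - 1) + 1"
      proof (cases "a = 1")
        case False
        then have "(a - 1, b) \<in> cells k h" using Suc.prems(1) by (auto simp: cells_def)
        then show ?thesis using earlier[of "a - 1" b] cell by simp
      qed (use height_nonneg in simp)
      show "int a \<le> height W i (b - 1 - 1)" if "b - 1 \<noteq> 0"
      proof -
        have "(a, b - 1) \<in> cells k h" using that Suc.prems(1) by (auto simp: cells_def)
        then show ?thesis using earlier[of a "b - 1"] cell by simp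
      qed
      show "W (Suc i) (int i + int (b - 1) + 1 - int a)"
        using blocked[OF Suc.prems(1)] entry cell by (simp add: of_nat_diff algebra_simps)
    qed
  qed
qed

definition sparse :: "nat \<Rightarrow> (nat \<Rightarrow> int \<Rightarrow> bool) \<Rightarrow> bool" where
  "sparse g W \<longleftrightarrow> (\<forall>i\<in>{1..g}. \<forall>u v. W i u \<and> W i v \<and> \<bar>u - v\<bar> \<le> int g \<longrightarrow> u = v)"

lemma sparseD:
  "sparse g W \<Longrightarrow> i \<in> {1..g} \<Longrightarrow> W i u \<Longrightarrow> W i v \<Longrightarrow> \<bar>u - v\<bar> \<le> int g \<Longrightarrow> u = v"
  unfolding sparse_def by blast

definition growth_tableau :: "(nat \<Rightarrow> int \<Rightarrow> bool) \<Rightarrow> nat \<times> nat \<Rightarrow> nat" where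
  "growth_tableau W = (\<lambda>(a, b). LEAST i. int a \<le> height W i (b - 1))"

lemma growth_tableau_le: "int a \<le> height W i (b - 1) \<Longrightarrow> growth_tableau W (a, b) \<le> i"
  by (simp add: growth_tableau_def Least_le)

lemma growth_tableauE:
  assumes "1 \<le> a" "int a \<le> height W g (b - 1)"
  obtains i where "i < g" "growth_tableau W (a, b) = Suc i" "height W (Suc i) (b - 1) = int a"
    "reach W i (b - 1) = int i + int (b - 1) + 1 - int a"
    "reach W (Suc i) (b - 1) = reach W i (b - 1)"
proof -
  let ?t = "growth_tableau W (a, b)"
  have t: "int a \<le> height W ?t (b - 1)" "?t \<le> g"
    unfolding growth_tableau_def using assms(2) by (auto intro: LeastI Least_le)
  then have "?t \<noteq> 0" using assms(1) by (intro notI) simp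
  then obtain i where i: "?t = Suc i" by (cases ?t) auto
  then have "\<not> int a \<le> height W i (b - 1)" using growth_tableau_le[of a W i b] by auto
  then have "reach W (Suc i) (b - 1) = reach W i (b - 1)" "height W i (b - 1) = int a - 1"
    using t(1) i by (auto simp: height_Suc of_bool_def split: if_splits)
  then show thesis using that[of i] i t(2) by (simp add: height_def)
qed

lemma growth_tableau_mono:
  assumes "1 \<le> a" "a \<le> a'" "b \<le> b'" "int a' \<le> height W g (b' - 1)"
  shows "growth_tableau W (a, b) \<le> growth_tableau W (a', b')"
proof (rule growth_tableau_le)
  obtain i where i: "growth_tableau W (a', b') = Suc i" "height W (Suc i) (b' - 1) = int a'"
    using growth_tableauE[of a' W g b'] assms by auto
  have "int a \<le> height W (Suc i) (b' - 1)" using i(2) assms(2) by simp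
  also have "\<dots> \<le> height W (Suc i) (b - 1)" using assms(3) by (intro height_antimono) simp
  finally show "int a \<le> height W (growth_tableau W (a', b')) (b - 1)" using i(1) by simp
qed

context
  fixes W :: "nat \<Rightarrow> int \<Rightarrow> bool" and g :: nat
  assumes sparse: "sparse g W"
begin

lemma height_less_if_box_added:
  assumes "i < g" "reach W (Suc i) (Suc j) = reach W i (Suc j)"
  shows "height W i (Suc j) < height W i j"
proof (rule ccontr)
  assume "\<not> ?thesis"
  then have eq: "reach W i (Suc j) = reach W i j + 1"
    using reach_add_1_le[of W i j] by (simp add: height_def)
  then have "reach W (Suc i) j = reach W i j"
    using assms(2) reach_add_1_le[of W "Suc i" j] reach_le_reach_Suc[of W i j] by simp
  then have "W (Suc i) (reach W i j)" "W (Suc i) (reach W i j + 1)"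
    using blocked_if_reach_Suc_eq[of W i j] blocked_if_reach_Suc_eq[OF assms(2)] eq by simp_all
  then have "reach W i j = reach W i j + 1"
    using assms(1) by (intro sparseD[OF sparse, of "Suc i"]) auto
  then show False by simp
qed

text \<open>
  The two values at which the boxes would be added differ by one more than a hook length of the
  diagram, hence by at most \<open>i + 1\<close>.
\<close>

lemma not_two_boxes_added:
  assumes "i < g" "j < j'" "(\<Sum>x<j'. height W i x) \<le> int i"
    and added: "reach W (Suc i) j = reach W i j" "reach W (Suc i) j' = reach W i j'"
  shows False
proof -
  obtain j0 where j0: "j' = Suc j0" using assms(2) by (cases j') auto
  have "height W i j' < height W i j0" using height_less_if_box_added[of i j0] assms j0 by simp
  then have pos: "1 \<le> height W i x" if "x < j'" for x
    using height_antimono[of x j0 W i] height_nonneg[of W i j'] that j0 by simp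
  have "height W i j + int (j' - 1) = height W i j + (\<Sum>x\<in>{..<j'} - {j}. 1)"
    using assms(2) by simp
  also have "\<dots> \<le> height W i j + (\<Sum>x\<in>{..<j'} - {j}. height W i x)"
    using pos by (intro add_left_mono sum_mono) auto
  also have "\<dots> = (\<Sum>x<j'. height W i x)"
    using assms(2) by (simp add: sum.remove)
  also have "\<dots> \<le> int i" by fact
  finally have "\<bar>reach W i j' - reach W i j\<bar> \<le> int g"
    using assms(1,2) height_nonneg[of W i j'] height_nonneg[of W i j]
      height_antimono[of j j' W i] by (simp add: height_def)
  then have "reach W i j' = reach W i j"
    using blocked_if_reach_Suc_eq assms(1) added by (intro sparseD[OF sparse, of "Suc i"]) auto
  then show False
    using reach_add_le[of W i j "j' - j"] assms(2) by simp
qed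

lemma sum_height_le: "i \<le> g \<Longrightarrow> (\<Sum>j<n. height W i j) \<le> int i"
proof (induction i arbitrary: n)
  case (Suc i)
  define J where "J = {j. j < n \<and> reach W (Suc i) j = reach W i j}"
  have "x = y" if "x \<in> J" "y \<in> J" for x y
    using not_two_boxes_added[of i x y] not_two_boxes_added[of i y x] Suc that
    by (cases x y rule: linorder_cases) (auto simp: J_def)
  moreover have "finite J" by (simp add: J_def)
  ultimately have "card J \<le> 1" by (metis card_le_Suc0_iff_eq One_nat_def)
  moreover have "(\<Sum>j<n. of_bool (reach W (Suc i) j = reach W i j)) = int (card J)"
    by (simp add: J_def sum.If_cases of_bool_def Int_def lessThan_def)
  moreover have "(\<Sum>j<n. height W i j) \<le> int i" using Suc by simp
  ultimately show ?case by (simp add: height_Suc sum.distrib)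
qed simp

lemma box_added_unique:
  assumes "i < g" "reach W (Suc i) j = reach W i j" "reach W (Suc i) j' = reach W i j'"
  shows "j = j'"
  using not_two_boxes_added[OF assms(1) _ sum_height_le] assms
  by (cases j j' rule: linorder_cases) auto

lemma growth_tableau_inj:
  assumes "1 \<le> a" "1 \<le> b" "int a \<le> height W g (b - 1)"
    and "1 \<le> a'" "1 \<le> b'" "int a' \<le> height W g (b' - 1)"
    and eq: "growth_tableau W (a, b) = growth_tableau W (a', b')"
  shows "(a, b) = (a', b')"
proof -
  obtain i where i: "i < g" "growth_tableau W (a, b) = Suc i" "height W (Suc i) (b - 1) = int a"
    "reach W (Suc i) (b - 1) = reach W i (b - 1)"
    using growth_tableauE[OF assms(1,3)] .
  obtain i' where i': "growth_tableau W (a', b') = Suc i'" "height W (Suc i') (b' - 1) = int a'"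
    "reach W (Suc i') (b' - 1) = reach W i' (b' - 1)"
    using growth_tableauE[OF assms(4,6)] .
  have "i' = i" using eq i(2) i'(1) by simp
  then have "b - 1 = b' - 1" using box_added_unique i i' by blast
  then show ?thesis using i(3) i'(2) \<open>i' = i\<close> assms(2,5) by simp
qed

lemma growth_tableau_filling:
  assumes full: "\<And>a b. (a, b) \<in> cells k h \<Longrightarrow> int a \<le> height W g (b - 1)"
  shows "restrict (growth_tableau W) (cells k h) \<in> fillings k h {1..g}"
proof -
  have cell: "1 \<le> a" "1 \<le> b" if "(a, b) \<in> cells k h" for a b using that by (auto simp: cells_def)
  have inj: "(a, b) = (a', b')"
    if "(a, b) \<in> cells k h" "(a', b') \<in> cells k h"
      "growth_tableau W (a, b) = growth_tableau W (a', b')" for a b a' b'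
    using growth_tableau_inj[OF cell full cell full] that by blast
  have less: "growth_tableau W (a, b) < growth_tableau W (a', b')"
    if "(a, b) \<in> cells k h" "(a', b') \<in> cells k h" "a \<le> a'" "b \<le> b'" "(a, b) \<noteq> (a', b')"
    for a b a' b'
    using growth_tableau_mono[OF cell(1) that(3,4) full] inj[OF that(1,2)] that
    by (metis le_neq_implies_less)
  have range: "growth_tableau W (a, b) \<in> {1..g}" if c: "(a, b) \<in> cells k h" for a b
  proof -
    obtain i where "i < g" "growth_tableau W (a, b) = Suc i"
      using growth_tableauE[OF cell(1)[OF c] full[OF c]] .
    then show ?thesis by simp
  qed
  show ?thesis
    unfolding fillings_def
  proof (intro CollectI conjI allI impI)
    show "restrict (growth_tableau W) (cells k h) \<in> cells k h \<rightarrow>\<^sub>E {1..g}"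
      using range by (auto simp: PiE_iff)
    show "inj_on (restrict (growth_tableau W) (cells k h)) (cells k h)"
      by (rule inj_onI) (use inj in \<open>auto\<close>)
  qed (use less in auto)
qed

lemma blocked_growth_tableau:
  assumes "1 \<le> a" "1 \<le> b" "int a \<le> height W g (b - 1)"
  shows "W (growth_tableau W (a, b)) (int (growth_tableau W (a, b)) - 1 + (int b - int a))"
proof -
  obtain i where i: "growth_tableau W (a, b) = Suc i"
    "reach W i (b - 1) = int i + int (b - 1) + 1 - int a"
    "reach W (Suc i) (b - 1) = reach W i (b - 1)"
    using growth_tableauE[OF assms(1,3)] .
  have "int i + int (b - 1) + 1 - int a = int (Suc i) - 1 + (int b - int a)"
    using assms(2) by simp
  then show ?thesis using blocked_if_reach_Suc_eq[OF i(3)] by (simp only: i(1,2))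
qed

theorem reach_le_iff_ex_filling:
  "reach W g r \<le> int g + int r - int h \<longleftrightarrow> (\<exists>T\<in>fillings (r + 1) h {1..g}.
     \<forall>(a, b)\<in>cells (r + 1) h. W (T (a, b)) (int (T (a, b)) - 1 + (int b - int a)))"
proof
  assume "reach W g r \<le> int g + int r - int h"
  then have h: "int h \<le> height W g r" by (simp add: height_def)
  have full: "int a \<le> height W g (b - 1)" if "(a, b) \<in> cells (r + 1) h" for a b
  proof -
    have "b - 1 \<le> r" "int a \<le> int h" using that by (auto simp: cells_def)
    then show ?thesis using h height_antimono[of "b - 1" r W g] by linarith
  qed
  show "\<exists>T\<in>fillings (r + 1) h {1..g}.
      \<forall>(a, b)\<in>cells (r + 1) h. W (T (a, b)) (int (T (a, b)) - 1 + (int b - int a))"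
    using growth_tableau_filling[OF full] blocked_growth_tableau full
    by (intro bexI[of _ "restrict (growth_tableau W) (cells (r + 1) h)"]) (auto simp: cells_def)
next
  assume "\<exists>T\<in>fillings (r + 1) h {1..g}.
    \<forall>(a, b)\<in>cells (r + 1) h. W (T (a, b)) (int (T (a, b)) - 1 + (int b - int a))"
  then obtain T where T: "T \<in> fillings (r + 1) h {1..g}"
    and blocked: "\<And>a b. (a, b) \<in> cells (r + 1) h \<Longrightarrow>
      W (T (a, b)) (int (T (a, b)) - 1 + (int b - int a))"
    by auto
  show "reach W g r \<le> int g + int r - int h"
  proof (cases "h = 0")
    case True
    then show ?thesis using reach_le[of W g r] by simp
  next
    case False
    then have corner: "(h, r + 1) \<in> cells (r + 1) h" by (auto simp: cells_def)
    then have "T (h, r + 1) \<le> g" using filling_in[OF T] by fastforce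
    then have "int h \<le> height W g r"
      using height_ge_if_filling[of T "r + 1" h "{1..g}" W h "r + 1" g] T blocked corner by simp
    then show ?thesis by (simp add: height_def)
  qed
qed

end


section \<open>Ranks of divisors on a chain of loops\<close>

lemma chips_mono: "effective D \<Longrightarrow> a \<le> b \<Longrightarrow> chips a D \<le> chips b D"
  unfolding chips_def by (rule frag_sum_mono) auto

lemma chips_nonneg: "effective D \<Longrightarrow> 0 \<le> chips n D"
  using chips_mono[of D 0 n] by simp

lemma chips_le_degree: "effective D \<Longrightarrow> chips n D \<le> degree D"
  unfolding chips_def degree_eq_frag_sum by (rule frag_sum_mono) auto

lemma position_if_no_chips_between:
  assumes "effective D" "chips b D \<le> chips a D" "a \<le> b" "p \<in> Poly_Mapping.keys D"
  shows "position p < a \<or> b \<le> position p"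
proof -
  let ?\<phi> = "\<lambda>p. of_bool (position p < b) - of_bool (position p < a) :: int"
  have "?\<phi> p = 0"
    using assms
    by (intro frag_sum_le_0_imp_eq_0[of D ?\<phi>]) (auto simp: chips_def frag_sum_fun_diff)
  then show ?thesis by (auto simp: of_bool_def split: if_splits)
qed

context chain_of_loops
begin

lemma div_coord_no_interior:
  assumes "1 \<le> i" "\<And>p. p \<in> Poly_Mapping.keys D \<Longrightarrow> position p \<noteq> 2 * i - 1"
  shows "div_coord i D = l i * of_int (degree D - chips (2 * i - 1) D)"
  unfolding chips_def degree_eq_frag_sum of_int_frag_sum frag_sum_fun_diff[symmetric]
    frag_sum_fun_cmul[symmetric]
proof (rule frag_sum_cong)
  fix p assume "p \<in> Poly_Mapping.keys D"
  then have "position p \<noteq> 2 * i - 1" by (rule assms(2))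
  then show "loop_coord i p = l i * of_int (1 - of_bool (position p < 2 * i - 1))"
    using assms(1) by (auto simp: loop_coord_def)
qed

definition blocked :: "(nat, chain_edge) divisor \<Rightarrow> nat \<Rightarrow> int \<Rightarrow> bool" where
  "blocked D i u \<longleftrightarrow> [div_coord i D = of_int (degree D - u) * l i] (rmod circumference i)"

lemma blocked_cong:
  assumes "(D, E) \<in> div_equiv \<Gamma>" "i \<in> {1..g}"
  shows "blocked D i u \<longleftrightarrow> blocked E i u"
proof -
  have cong: "[div_coord i D = div_coord i E] (rmod circumference i)"
    and "degree D = degree E"
    using assms by (auto simp: div_equiv_iff)
  then show ?thesis
    unfolding blocked_def using rcong_trans[OF cong] rcong_trans[OF rcong_sym[OF cong]] by auto
qed

lemma blocked_diff_iff:
  assumes "1 \<le> i" "\<And>p. p \<in> Poly_Mapping.keys D' \<Longrightarrow> position p \<noteq> 2 * i - 1"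
  shows "blocked (D - D') i u \<longleftrightarrow> blocked D i (u + chips (2 * i - 1) D')"
proof -
  have coord: "div_coord i D' = l i * of_int (degree D' - chips (2 * i - 1) D')"
    using assms by (rule div_coord_no_interior)
  show ?thesis
    unfolding blocked_def rcong_conv_diff_rmod_eq_0 frag_sum_diff degree_diff coord
    by (simp add: algebra_simps)
qed

lemma blocked_twice_rcong:
  assumes "blocked D i u" "blocked D i v"
  shows "[of_int u * l i = of_int v * l i] (rmod circumference i)"
proof -
  have "[of_int (degree D - u) * l i = of_int (degree D - v) * l i] (rmod circumference i)"
    using assms unfolding blocked_def using rcong_sym rcong_trans by blast
  then show ?thesis by (simp add: left_diff_distrib)
qed

lemma not_blocked_consecutive:
  assumes "i \<in> {1..g}"
  shows "\<not> (blocked D i u \<and> blocked D i (u + 1))"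
proof
  assume "blocked D i u \<and> blocked D i (u + 1)"
  then have "[of_int (u + 1) * l i = of_int u * l i] (rmod circumference i)"
    using blocked_twice_rcong by blast
  then have "(l i) rmod circumference i = 0"
    unfolding rcong_conv_diff_rmod_eq_0 by (simp add: algebra_simps)
  moreover have "(l i) rmod circumference i = l i"
    using l_pos[OF assms] m_pos[OF assms] by (intro rmod_idem) auto
  ultimately show False using l_pos[OF assms] by simp
qed

lemma reach_le_chips:
  assumes F: "effective F"
  shows "reach (blocked F) i 0 \<le> chips (2 * i) F"
proof (induction i)
  case (Suc i)
  let ?u = "reach (blocked F) i 0"
  have mono: "chips (2 * i) F \<le> chips (2 * i + 1) F" "chips (2 * i + 1) F \<le> chips (2 * Suc i) F"
    using F by (auto intro: chips_mono)
  show ?case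
  proof (cases "?u = chips (2 * Suc i) F")
    case False
    then show ?thesis using Suc mono advance_le[of "blocked F (Suc i)" ?u] by simp
  next
    case True
    then have no_interior: "chips (2 * Suc i) F \<le> chips (2 * i + 1) F"
      and u: "?u = chips (2 * i + 1) F"
      using Suc mono by auto
    have "div_coord (Suc i) F = l (Suc i) * of_int (degree F - chips (2 * Suc i - 1) F)"
    proof (rule div_coord_no_interior)
      fix p assume "p \<in> Poly_Mapping.keys F"
      from position_if_no_chips_between[OF F no_interior _ this]
      show "position p \<noteq> 2 * Suc i - 1" by auto
    qed simp
    then have "blocked F (Suc i) ?u" by (simp add: blocked_def u mult.commute)
    then show ?thesis using True by (simp add: advance_def)
  qed
qed simp

lemma ex_effective_if_reach_le:
  assumes D: "D \<in> divisors \<Gamma>" and le: "reach (blocked D) g 0 \<le> degree D"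
  shows "\<exists>F\<in>divisors \<Gamma>. effective F \<and> (D, F) \<in> div_equiv \<Gamma>"
proof -
  define u where "u i = reach (blocked D) i 0" for i
  define S where "S = {i \<in> {1..g}. \<not> blocked D i (u (i - 1))}"
  define E :: "(nat, chain_edge) divisor" where
    "E = frag_cmul (degree D - u g) (frag_of (Vertex g))"
  have S: "S \<subseteq> {1..g}" by (auto simp: S_def)
  have E: "E \<in> divisors \<Gamma>"
    unfolding E_def by (intro frag_cmul_in_divisors frag_of_in_divisors Vertex_in_points) simp
  have card_S: "int (card (S \<inter> {i<..})) = u g - u i" if "i \<le> g" for i
  proof -
    have "S \<inter> {i<..} = {j \<in> {i<..g}. \<not> blocked D j (reach (blocked D) (j - 1) 0)}"
      by (auto simp: S_def u_def)
    then show ?thesis using reach_no_jumps_diff[OF that, of "blocked D"] by (simp add: u_def)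
  qed
  have "S \<inter> {0<..} = S" using S by auto
  then have degree: "degree D = degree E + int (card S)"
    using card_S[of 0] by (simp add: E_def degree_eq_frag_sum frag_sum_cmul u_def)
  have fixed:
    "[div_coord i E + l i * real (card (S \<inter> {i<..})) = div_coord i D] (rmod circumference i)"
    if i: "i \<in> {1..g} - S" for i
  proof -
    have card: "real (card (S \<inter> {i<..})) = of_int (u g - u i)"
      using arg_cong[OF card_S[of i], of real_of_int] i by simp
    have "div_coord i E = l i * of_int (degree D - u g)"
      using i by (simp add: E_def frag_sum_cmul loop_coord_def)
    then have "div_coord i E + l i * real (card (S \<inter> {i<..})) = of_int (degree D - u i) * l i"
      unfolding card by (simp add: algebra_simps)
    moreover have "blocked D i (u i)"
      using blocked_after_blocked_round[of i "blocked D"] i by (simp add: S_def u_def)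
    ultimately show ?thesis by (simp add: blocked_def rcong_sym)
  qed
  obtain x where equiv: "(D, E + (\<Sum>j\<in>S. frag_of (x j))) \<in> div_equiv \<Gamma>"
    using ex_equiv_add_loop_points_iff[OF E D degree S] fixed by blast
  have "effective (E + (\<Sum>j\<in>S. frag_of (x j)))"
    unfolding E_def using le
    by (intro effective_add effective_sum effective_frag_cmul effective_frag_of) (simp add: u_def)
  then show ?thesis using equiv div_equiv_iff by blast
qed

theorem effective_class_iff:
  assumes D: "D \<in> divisors \<Gamma>"
  shows "(\<exists>F\<in>divisors \<Gamma>. effective F \<and> (D, F) \<in> div_equiv \<Gamma>) \<longleftrightarrow> reach (blocked D) g 0 \<le> degree D"
proof
  assume "\<exists>F\<in>divisors \<Gamma>. effective F \<and> (D, F) \<in> div_equiv \<Gamma>"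
  then obtain F where F: "effective F" "(D, F) \<in> div_equiv \<Gamma>" by blast
  have "reach (blocked D) g 0 = reach (blocked F) g 0"
    using blocked_cong[OF F(2)] by (rule reach_cong)
  also have "\<dots> \<le> chips (2 * g) F" using F(1) by (rule reach_le_chips)
  also have "\<dots> \<le> degree F" using F(1) by (rule chips_le_degree)
  also have "\<dots> = degree D" using F(2) by (simp add: div_equiv_iff)
  finally show "reach (blocked D) g 0 \<le> degree D" .
qed (rule ex_effective_if_reach_le[OF D])

lemma reach_diff_le_loop:
  assumes D': "effective D'" and "Suc i \<le> g"
    and j: "chips (2 * i + 1) D' = int j" and j': "chips (2 * Suc i) D' = int j'"
    and IH: "reach (blocked (D - D')) i 0 + int j \<le> reach (blocked D) i j"
  shows "reach (blocked (D - D')) (Suc i) 0 + int j' \<le> reach (blocked D) (Suc i) j'"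
proof (cases "j' = j")
  case True
  let ?u = "reach (blocked (D - D')) i 0"
  have "blocked (D - D') (Suc i) ?u \<longleftrightarrow> blocked D (Suc i) (?u + chips (2 * Suc i - 1) D')"
  proof (rule blocked_diff_iff)
    fix p assume "p \<in> Poly_Mapping.keys D'"
    then have "position p < 2 * i + 1 \<or> 2 * Suc i \<le> position p"
      using True j j' by (intro position_if_no_chips_between[OF D']) auto
    then show "position p \<noteq> 2 * Suc i - 1" by auto
  qed simp
  then have "reach (blocked (D - D')) (Suc i) 0 + int j = advance (blocked D (Suc i)) (?u + int j)"
    using j by (simp add: advance_def)
  also have "\<dots> \<le> advance (blocked D (Suc i)) (reach (blocked D) i j)" by (rule advance_mono[OF IH])
  also have "\<dots> \<le> reach (blocked D) (Suc i) j" by (rule advance_reach_le)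
  finally show ?thesis using True by simp
next
  case False
  moreover have "int j \<le> int j'"
    unfolding j[symmetric] j'[symmetric] by (rule chips_mono[OF D']) simp
  ultimately have "j < j'" by simp
  then have "reach (blocked D) i j + int (j' - j) + 1 \<le> reach (blocked D) (Suc i) (j + (j' - j))"
    using not_blocked_consecutive[of "Suc i"] assms(2) by (intro reach_Suc_add_ge) auto
  then show ?thesis using IH reach_Suc_le[of "blocked (D - D')" i 0] \<open>j < j'\<close> by simp
qed

lemma reach_diff_le:
  assumes D': "effective D'"
  shows "i \<le> g \<Longrightarrow> chips (2 * i + 1) D' = int j \<Longrightarrow>
    reach (blocked (D - D')) i 0 + int j \<le> reach (blocked D) i j"
proof (induction i arbitrary: j)
  case (Suc i)
  obtain j0 j1 where j0: "chips (2 * i + 1) D' = int j0" and j1: "chips (2 * Suc i) D' = int j1"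
    using chips_nonneg[OF D'] nonneg_int_cases by metis
  have "int j1 \<le> int j"
    unfolding j1[symmetric] Suc.prems(2)[symmetric] by (rule chips_mono[OF D']) simp
  then obtain q where q: "j = j1 + q" using le_Suc_ex by auto
  have "reach (blocked (D - D')) (Suc i) 0 + int j1 \<le> reach (blocked D) (Suc i) j1"
    using Suc j0 by (intro reach_diff_le_loop[OF D' _ j0 j1]) auto
  then show ?case using reach_add_le[of "blocked D" "Suc i" j1 q] q by simp
qed simp

definition attains_reach ::
  "(nat, chain_edge) divisor \<Rightarrow> nat \<Rightarrow> nat \<Rightarrow> (nat, chain_edge) divisor \<Rightarrow> bool" where
  "attains_reach D i j D' \<longleftrightarrow>
     D' \<in> divisors \<Gamma> \<and> effective D' \<and> degree D' = int j \<and> Poly_Mapping.keys D' \<subseteq> Vertex ` {..i} \<and>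
     reach (blocked (D - D')) i 0 + int j = reach (blocked D) i j"

lemma attains_reach_advance:
  assumes D': "attains_reach D i j D'"
    and reach: "reach (blocked D) (Suc i) j = advance (blocked D (Suc i)) (reach (blocked D) i j)"
  shows "attains_reach D (Suc i) j D'"
proof -
  have keys: "Poly_Mapping.keys D' \<subseteq> Vertex ` {..i}" using D' by (simp add: attains_reach_def)
  have "chips (2 * Suc i - 1) D' = degree D'"
    unfolding chips_def degree_eq_frag_sum using keys by (intro frag_sum_cong) force
  moreover have "blocked (D - D') (Suc i) u \<longleftrightarrow>
      blocked D (Suc i) (u + chips (2 * Suc i - 1) D')" for u
    by (rule blocked_diff_iff) (use keys in force)+
  ultimately show ?thesis
    using D' reach by (auto simp: attains_reach_def advance_def)
qed

lemma attains_reach_jump: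
  assumes D': "attains_reach D i j D'" and "i \<le> g"
    and reach: "reach (blocked D) i (Suc j) = reach (blocked D) i j + 1"
  shows "attains_reach D i (Suc j) (D' + frag_of (Vertex i))"
proof -
  have "blocked (D - D' - frag_of (Vertex i)) i' u \<longleftrightarrow> blocked (D - D') i' u"
    if "i' \<in> {1..i}" for i' u
  proof -
    have "chips (2 * i' - 1) (frag_of (Vertex i)) = 0"
      using that by (auto simp: chips_def)
    moreover have "2 * i \<noteq> 2 * i' - 1" using that by presburger
    ultimately show ?thesis
      using blocked_diff_iff[of i' "frag_of (Vertex i)" "D - D'" u] that by (simp add: keys_frag_of)
  qed
  then have "reach (blocked (D - (D' + frag_of (Vertex i)))) i 0 = reach (blocked (D - D')) i 0"
    unfolding diff_diff_eq[symmetric] by (rule reach_cong)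
  moreover have "Poly_Mapping.keys (D' + frag_of (Vertex i)) \<subseteq> Vertex ` {..i}"
    using D' Poly_Mapping.keys_add[of D' "frag_of (Vertex i)"]
    by (auto simp: attains_reach_def keys_frag_of)
  ultimately show ?thesis
    using D' reach Vertex_in_points[OF \<open>i \<le> g\<close>]
    by (simp add: attains_reach_def effective_add effective_frag_of add_in_divisors
        frag_of_in_divisors degree_eq_frag_sum frag_sum_add)
qed

lemma ex_attains_reach: "i \<le> g \<Longrightarrow> \<exists>D'. attains_reach D i j D'"
proof (induction "i + j" arbitrary: i j rule: less_induct)
  case less
  show ?case
  proof (cases rule: reach_cases[where i = i and j = j and W = "blocked D"])
    case start
    have "attains_reach D 0 0 0"
      by (simp add: attains_reach_def zero_in_divisors effective_def degree_eq_frag_sum)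
    then show ?thesis using start by blast
  next
    case (advance i')
    then obtain D' where "attains_reach D i' j D'" using less.hyps[of i' j] less.prems by auto
    then show ?thesis using attains_reach_advance advance by blast
  next
    case (jump j')
    then obtain D' where "attains_reach D i j' D'" using less.hyps[of i j'] less.prems by auto
    then show ?thesis using attains_reach_jump less.prems jump by blast
  qed
qed

theorem rank_at_least_iff:
  assumes D: "D \<in> divisors \<Gamma>"
  shows "rank_at_least \<Gamma> D r \<longleftrightarrow> reach (blocked D) g r \<le> degree D"
proof
  assume reach: "reach (blocked D) g r \<le> degree D"
  show "rank_at_least \<Gamma> D r"
    unfolding rank_at_least_def
  proof (intro ballI impI)
    fix D' assume D': "D' \<in> divisors \<Gamma>" "effective D' \<and> degree D' = int r"
    have "reach (blocked (D - D')) g 0 + int r \<le> reach (blocked D) g r"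
      using reach_diff_le[of D' g r D] D' chips_eq_degree[OF D'(1)] by simp
    then have "reach (blocked (D - D')) g 0 \<le> degree (D - D')"
      using reach D' by (simp add: degree_diff)
    then show "\<exists>F\<in>divisors \<Gamma>. effective F \<and> (D - D', F) \<in> div_equiv \<Gamma>"
      using effective_class_iff[OF diff_in_divisors[OF D D'(1)]] by blast
  qed
next
  assume rank: "rank_at_least \<Gamma> D r"
  obtain D' where D': "D' \<in> divisors \<Gamma>" "effective D'" "degree D' = int r"
    and attains: "reach (blocked (D - D')) g 0 + int r = reach (blocked D) g r"
    using ex_attains_reach[OF order_refl] unfolding attains_reach_def by blast
  have "\<exists>F\<in>divisors \<Gamma>. effective F \<and> (D - D', F) \<in> div_equiv \<Gamma>"
    using rank D' by (simp add: rank_at_least_def)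
  then have "reach (blocked (D - D')) g 0 \<le> degree (D - D')"
    using effective_class_iff[OF diff_in_divisors[OF D D'(1)]] by blast
  then show "reach (blocked D) g r \<le> degree D"
    using attains D'(3) by (simp add: degree_diff)
qed

end


section \<open>The Brill-Noether locus\<close>

context chain_of_loops
begin

definition blocking_torus ::
  "int \<Rightarrow> nat set \<Rightarrow> (nat \<Rightarrow> int) \<Rightarrow> (nat, chain_edge) divisor set set" where
  "blocking_torus d I u =
     {div_class \<Gamma> D | D. D \<in> divisors \<Gamma> \<and> degree D = d \<and> (\<forall>i\<in>I. blocked D i (u i))}"

lemma div_class_in_blocking_torus_iff:
  assumes "I \<subseteq> {1..g}" "D \<in> divisors \<Gamma>"
  shows "div_class \<Gamma> D \<in> blocking_torus d I u \<longleftrightarrow> degree D = d \<and> (\<forall>i\<in>I. blocked D i (u i))"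
proof
  assume "div_class \<Gamma> D \<in> blocking_torus d I u"
  then obtain E where E: "E \<in> divisors \<Gamma>" "degree E = d" "\<forall>i\<in>I. blocked E i (u i)"
    "div_class \<Gamma> D = div_class \<Gamma> E"
    by (auto simp: blocking_torus_def)
  then have "(D, E) \<in> div_equiv \<Gamma>" using div_class_eq_iff[OF assms(2) E(1)] by simp
  then show "degree D = d \<and> (\<forall>i\<in>I. blocked D i (u i))"
    using E(2,3) assms(1) blocked_cong by (auto simp: div_equiv_iff)
qed (use assms(2) in \<open>auto simp: blocking_torus_def\<close>)

lemma blocking_torus_subset_Pic: "blocking_torus d I u \<subseteq> Pic \<Gamma> d"
  by (auto simp: blocking_torus_def in_Pic_iff)

text \<open>
  The loops outside \<open>I\<close> may carry a chip anywhere; a chip on a loop further to the right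
  contributes \<open>l i\<close> to the \<open>i\<close>-th coordinate, which the choice of \<open>E\<close> compensates.
\<close>

theorem is_loop_product_blocking_torus:
  assumes I: "I \<subseteq> {1..g}"
  shows "is_loop_product g l m d ({1..g} - I) (blocking_torus d I u)"
proof -
  let ?S = "{1..g} - I"
  let ?n = "\<lambda>i. real (card (?S \<inter> {i<..}))"
  obtain E where E: "E \<in> divisors \<Gamma>" "degree E = d - int (card ?S)"
    and E_coord: "\<And>i. i \<in> {1..g} \<Longrightarrow>
      [div_coord i E = of_int (d - u i) * l i - l i * ?n i] (rmod circumference i)"
    using ex_divisor_with_coords[of "d - int (card ?S)" "\<lambda>i. of_int (d - u i) * l i - l i * ?n i"]
    by blast
  let ?loops = "\<lambda>x. \<forall>i\<in>?S. x i \<in> chain_loop g l m i"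
  define F where "F x = E + (\<Sum>i\<in>?S. frag_of (x i))" for x :: "nat \<Rightarrow> (nat, chain_edge) gpoint"
  have F: "F x \<in> divisors \<Gamma> \<and> degree (F x) = d" if "?loops x" for x
    unfolding F_def degree_add_loop_points
    using add_loop_points_in_divisors[OF E(1) Diff_subset, of I x] that E(2) by auto
  have blocked_iff: "blocked D i (u i) \<longleftrightarrow>
      [div_coord i E + l i * ?n i = div_coord i D] (rmod circumference i)"
    if "degree D = d" "i \<in> I" for D i
  proof -
    have "[div_coord i E + l i * ?n i = of_int (d - u i) * l i] (rmod circumference i)"
      using rcong_add[OF E_coord rcong_refl, of i "l i * ?n i"] that(2) I by auto
    then show ?thesis unfolding blocked_def that(1) using rcong_sym rcong_trans by blast
  qed
  have "(\<forall>i\<in>I. blocked D i (u i)) \<longleftrightarrow> (\<exists>x. ?loops x \<and> (D, F x) \<in> div_equiv \<Gamma>)"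
    if D: "D \<in> divisors \<Gamma>" "degree D = d" for D
  proof -
    have "{1..g} - ?S = I" using I by auto
    then show ?thesis
      using ex_equiv_add_loop_points_iff[OF E(1) D(1) _ Diff_subset, of I] E(2) D(2) blocked_iff
      by (simp add: F_def)
  qed
  then have "blocking_torus d I u = {div_class \<Gamma> D | D. D \<in> divisors \<Gamma> \<and> degree D = d \<and>
      (\<exists>x. ?loops x \<and> (D, F x) \<in> div_equiv \<Gamma>)}"
    unfolding blocking_torus_def by blast
  also have "\<dots> = {div_class \<Gamma> (F x) | x. ?loops x}"
    using F div_class_eq_iff by blast
  finally show ?thesis
    unfolding is_loop_product_def F_def
    by (intro conjI bexI[OF _ E(1)] Diff_subset blocking_torus_subset_Pic)
qed

lemma not_rcong_add_half_circumference:
  assumes "i \<in> {1..g}"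
  shows "\<not> [c + circumference i / 2 = c] (rmod circumference i)"
proof
  assume "[c + circumference i / 2 = c] (rmod circumference i)"
  then have "(circumference i / 2) rmod circumference i = 0"
    by (simp add: rcong_conv_diff_rmod_eq_0)
  moreover have "(circumference i / 2) rmod circumference i = circumference i / 2"
    using l_pos[OF assms] m_pos[OF assms] by (intro rmod_idem) auto
  ultimately show False using l_pos[OF assms] m_pos[OF assms] by simp
qed

lemma blocking_torus_subsetD:
  assumes I: "I \<subseteq> {1..g}" "I' \<subseteq> {1..g}"
    and sub: "blocking_torus d I u \<subseteq> blocking_torus d I' u'"
  shows "I' \<subseteq> I" and "\<exists>D. \<forall>i\<in>I'. blocked D i (u i) \<and> blocked D i (u' i)"
proof -
  define c where "c i = (if i \<in> I then of_int (d - u i) * l i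
    else of_int (d - u' i) * l i + circumference i / 2)" for i
  obtain D where D: "D \<in> divisors \<Gamma>" "degree D = d"
    and coord: "\<And>i. i \<in> {1..g} \<Longrightarrow> [div_coord i D = c i] (rmod circumference i)"
    using ex_divisor_with_coords[of d c] by blast
  have on_I: "\<forall>i\<in>I. blocked D i (u i)"
  proof
    fix i assume i: "i \<in> I"
    then have "c i = of_int (d - u i) * l i" by (simp add: c_def)
    then show "blocked D i (u i)"
      using coord[of i] i I(1) unfolding blocked_def D(2) by auto
  qed
  then have "div_class \<Gamma> D \<in> blocking_torus d I' u'"
    using sub D by (auto simp: blocking_torus_def)
  then have on_I': "\<forall>i\<in>I'. blocked D i (u' i)"
    using div_class_in_blocking_torus_iff[OF I(2) D(1)] by blast
  show "I' \<subseteq> I"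
  proof (rule subsetI, rule ccontr)
    fix i assume i: "i \<in> I'" "i \<notin> I"
    then have "[c i = of_int (d - u' i) * l i] (rmod circumference i)"
      using on_I' coord[of i] I(2) unfolding blocked_def D(2) using rcong_sym rcong_trans by blast
    then show False
      using not_rcong_add_half_circumference[of i] i I(2) by (auto simp: c_def)
  qed
  then show "\<exists>D. \<forall>i\<in>I'. blocked D i (u i) \<and> blocked D i (u' i)"
    using on_I on_I' by blast
qed

text \<open>
  The box in row \<open>a\<close> and column \<open>b\<close> is added in round \<open>i\<close> if \<open>height W (i - 1) (b - 1) = a - 1\<close> and
  the value \<open>reach W (i - 1) (b - 1) = i - 1 + b - a\<close> is blocked.
\<close>

definition tableau_torus ::
  "int \<Rightarrow> nat \<Rightarrow> nat \<Rightarrow> (nat \<times> nat \<Rightarrow> nat) \<Rightarrow> (nat, chain_edge) divisor set set" where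
  "tableau_torus d k h T =
     blocking_torus d (T ` cells k h) (\<lambda>i. int i - 1 + entry_content k h T i)"

lemma is_loop_product_tableau_torus:
  assumes "T \<in> fillings k h {1..g}"
  shows "is_loop_product g l m d ({1..g} - T ` cells k h) (tableau_torus d k h T)"
  unfolding tableau_torus_def using filling_in[OF assms]
  by (intro is_loop_product_blocking_torus) blast

lemma div_class_in_tableau_torus_iff:
  assumes T: "T \<in> fillings k h {1..g}" and D: "D \<in> divisors \<Gamma>"
  shows "div_class \<Gamma> D \<in> tableau_torus d k h T \<longleftrightarrow> degree D = d \<and>
    (\<forall>(a, b)\<in>cells k h. blocked D (T (a, b)) (int (T (a, b)) - 1 + (int b - int a)))"
proof -
  have "T ` cells k h \<subseteq> {1..g}" using filling_in[OF T] by blast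
  then show ?thesis
    using D by (auto simp: tableau_torus_def div_class_in_blocking_torus_iff entry_content[OF T])
qed

end

locale general_chain_of_loops =
  fixes g :: nat and l m :: "nat \<Rightarrow> real"
  assumes general: "general_chain g l m"

sublocale general_chain_of_loops \<subseteq> chain_of_loops
  using general by unfold_locales (auto simp: general_chain_def)

context general_chain_of_loops
begin

lemma multiple_neq_circumference_multiple:
  fixes n q :: int
  assumes i: "i \<in> {1..g}" and n: "0 < n" "n \<le> int g"
  shows "of_int n * l i \<noteq> of_int q * circumference i"
proof
  assume eq: "of_int n * l i = of_int q * circumference i"
  have lm: "0 < l i" "0 < m i" using l_pos[OF i] m_pos[OF i] by auto
  have "0 < of_int q * circumference i" using n lm by (simp flip: eq)
  then have q: "0 < q" using lm by (simp add: zero_less_mult_iff)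
  have eq': "of_int (n - q) * l i = of_int q * m i" using eq by (simp add: algebra_simps)
  moreover have "0 < of_int q * m i" using q lm by simp
  ultimately have "0 < of_int (n - q) * l i" by simp
  then have nq: "0 < n - q" using lm by (simp add: zero_less_mult_iff)
  have "l i / m i = of_int q / of_int (n - q)"
    using eq' nq lm by (simp add: field_simps)
  moreover have "q < 2 * int g - 2" "n - q < 2 * int g - 2" using q nq n by auto
  ultimately show False
    using general i q nq unfolding general_chain_def by blast
qed

lemma sparse_blocked: "sparse g (blocked D)"
proof -
  have less: False
    if i: "i \<in> {1..g}" and blocked: "blocked D i u" "blocked D i v" and uv: "v - u \<le> int g" "u < v"
    for i u v
  proof -
    obtain q where "of_int v * l i = of_int u * l i + of_int q * circumference i"
      using blocked_twice_rcong[OF blocked] by (auto simp: rcong_altdef)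
    then have "of_int (v - u) * l i = of_int q * circumference i" by (simp add: algebra_simps)
    then show False using multiple_neq_circumference_multiple[OF i, of "v - u" q] uv by simp
  qed
  show ?thesis
    unfolding sparse_def
  proof (intro ballI allI impI)
    fix i u v assume "i \<in> {1..g}" "blocked D i u \<and> blocked D i v \<and> \<bar>u - v\<bar> \<le> int g"
    then show "u = v" using less[of i u v] less[of i v u]
      by (cases u v rule: linorder_cases) auto
  qed
qed

theorem brill_noether_locus_eq:
  assumes h: "int h = int g - d + int r"
  shows "brill_noether_locus \<Gamma> d r = (\<Union>T\<in>fillings (r + 1) h {1..g}. tableau_torus d (r + 1) h T)"
    (is "_ = ?tori")
proof -
  have tori: "div_class \<Gamma> D \<in> ?tori \<longleftrightarrow> degree D = d \<and> rank_at_least \<Gamma> D r"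
    if D: "D \<in> divisors \<Gamma>" for D
  proof -
    have "div_class \<Gamma> D \<in> ?tori \<longleftrightarrow> degree D = d \<and> reach (blocked D) g r \<le> int g + int r - int h"
      unfolding reach_le_iff_ex_filling[OF sparse_blocked]
      using div_class_in_tableau_torus_iff[OF _ D] by blast
    then show ?thesis using h by (auto simp: rank_at_least_iff[OF D])
  qed
  show ?thesis
  proof (intro equalityI subsetI)
    fix C assume "C \<in> brill_noether_locus \<Gamma> d r"
    then obtain D0 D where D0: "D0 \<in> divisors \<Gamma>" "degree D0 = d" "C = div_class \<Gamma> D0"
      and D: "D \<in> divisors \<Gamma>" "C = div_class \<Gamma> D" "rank_at_least \<Gamma> D r"
      unfolding brill_noether_locus_def in_Pic_iff by blast
    then have "(D0, D) \<in> div_equiv \<Gamma>" using div_class_eq_iff[OF D0(1) D(1)] by simp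
    then have "degree D = d" using D0 by (simp add: div_equiv_iff)
    then show "C \<in> ?tori" using D tori by blast
  next
    fix C assume C: "C \<in> ?tori"
    then obtain D where D: "D \<in> divisors \<Gamma>" "C = div_class \<Gamma> D"
      unfolding tableau_torus_def blocking_torus_def by blast
    then show "C \<in> brill_noether_locus \<Gamma> d r"
      using C tori[OF D(1)] unfolding brill_noether_locus_def in_Pic_iff by blast
  qed
qed

theorem inj_on_tableau_torus: "inj_on (tableau_torus d k h) (fillings k h {1..g})"
proof (rule inj_onI)
  fix T T' assume T: "T \<in> fillings k h {1..g}" and T': "T' \<in> fillings k h {1..g}"
    and eq: "tableau_torus d k h T = tableau_torus d k h T'"
  let ?I = "T ` cells k h" and ?I' = "T' ` cells k h"
  have I: "?I \<subseteq> {1..g}" "?I' \<subseteq> {1..g}" using filling_in[OF T] filling_in[OF T'] by auto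
  have image: "?I = ?I'"
    using blocking_torus_subsetD(1)[OF I] blocking_torus_subsetD(1)[OF I(2,1)] eq
    unfolding tableau_torus_def by blast
  obtain D where D: "\<And>i. i \<in> ?I' \<Longrightarrow>
      blocked D i (int i - 1 + entry_content k h T i) \<and>
      blocked D i (int i - 1 + entry_content k h T' i)"
    using blocking_torus_subsetD(2)[OF I] eq unfolding tableau_torus_def by blast
  have content: "entry_content k h T i = entry_content k h T' i" if i: "i \<in> ?I'" for i
  proof -
    have "int i - 1 + entry_content k h T i = int i - 1 + entry_content k h T' i"
      using D[OF i] entry_content_diff_le[OF T T', of i] i I(2) image
      by (intro sparseD[OF sparse_blocked, of i]) auto
    then show ?thesis by simp
  qed
  show "T = T'"
  proof (rule filling_eqI_diagonals[OF T T'])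
    show "T ` diagonal k h \<delta> = T' ` diagonal k h \<delta>" for \<delta>
      using image content by (auto simp: filling_image_diagonal[OF T] filling_image_diagonal[OF T'])
  qed
qed

end

lemma int_binomial_diff: "int_binomial n (int n - int j) = n choose j"
proof (cases "j \<le> n")
  case True
  then have "nat (int n - int j) = n - j" by simp
  then show ?thesis using True binomial_symmetric[OF True] by (simp add: int_binomial_def)
next
  case False
  then show ?thesis by (simp add: int_binomial_def binomial_eq_0)
qed

theorem theorem2p8:
  fixes g r k :: nat and d kbar \<rho> :: int and l m :: "nat \<Rightarrow> real"
  assumes "general_chain g l m"
    and "k = r + 1"
    and "kbar = int g - d + int r"
    and "0 \<le> kbar"
    and "\<rho> = int g - int k * kbar"
  shows "\<exists>P.
      (\<forall>T\<in>fillings k (nat kbar) {1..g}.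
         int (card ({1..g} - T ` cells k (nat kbar))) = \<rho> \<and>
         is_loop_product g l m d ({1..g} - T ` cells k (nat kbar)) (P T)) \<and>
      inj_on P (fillings k (nat kbar) {1..g}) \<and>
      card (P ` fillings k (nat kbar) {1..g}) = int_binomial g \<rho> * num_syt k (nat kbar) \<and>
      (\<forall>A. A \<subseteq> {1..g} \<and> int (card A) = int g - \<rho> \<longrightarrow>
         card (fillings k (nat kbar) A) = num_syt k (nat kbar)) \<and>
      brill_noether_locus (loop_chain g l m) d r = (\<Union>T\<in>fillings k (nat kbar) {1..g}. P T)"
proof -
  interpret general_chain_of_loops g l m
    using assms(1) by unfold_locales
  define h where "h = nat kbar"
  have h: "int h = int g - d + int r" and \<rho>: "\<rho> = int g - int (k * h)"
    using assms(3-5) by (simp_all add: h_def)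
  show ?thesis
    unfolding h_def[symmetric]
  proof (intro exI[of _ "tableau_torus d k h"] conjI ballI allI impI)
    fix T assume T: "T \<in> fillings k h {1..g}"
    show "int (card ({1..g} - T ` cells k h)) = \<rho>"
      unfolding \<rho> using T by (rule card_diff_filling_image)
    show "is_loop_product g l m d ({1..g} - T ` cells k h) (tableau_torus d k h T)"
      using T by (rule is_loop_product_tableau_torus)
  next
    show "card (tableau_torus d k h ` fillings k h {1..g}) = int_binomial g \<rho> * num_syt k h"
      by (simp only: \<rho> int_binomial_diff card_image[OF inj_on_tableau_torus] card_fillings
          finite_atLeastAtMost card_atLeastAtMost diff_Suc_1)
  next
    fix A assume "A \<subseteq> {1..g} \<and> int (card A) = int g - \<rho>"
    then have "finite A" "int (card A) = int (k * h)" using \<rho> finite_subset by auto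
    then show "card (fillings k h A) = num_syt k h"
      by (simp only: of_nat_eq_iff card_fillings_eq_num_syt)
  next
    show "brill_noether_locus \<Gamma> d r = (\<Union>T\<in>fillings k h {1..g}. tableau_torus d k h T)"
      unfolding assms(2) using h by (rule brill_noether_locus_eq)
  qed (rule inj_on_tableau_torus)
qed

end
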